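(* Let $R\ge R_0=\|x^0-x^*\|$, $Q=B_{3R}(x^* )$, and assume that $\mathbb{E}\|F_\xi(x)-F(x)\|^2\le\sigma^2$ for all $x\in Q$, $\|F(x)-F(y)\|\le L\|x-y\|$ for all $x,y\in Q$, and, for some $\rho\ge0$ and any solution $x^*\in\mathcal X^*$, $\langle F(x),x-x^*\rangle\ge-\rho\|F(x)\|^2$ for all $x\in Q$. Let $K\ge0$ be an integer and $\beta\in(0,1]$ with $\ln\frac{6(K+1)}\beta\ge1$, and suppose $$\rho\le\frac1{640L\ln\frac{6(K+1)}\beta}.$$ Consider clipped-SEG with constant batchsizes $m_{1,k}\equiv m_1$, $m_{2,k}\equiv m_2$ and clipping levels $\lambda_{1,k}\equiv\lambda_1=\frac R{20\gamma_1\ln\frac{6(K+1)}\beta}$, $\lambda_{2,k}\equiv\lambda_2=\frac R{20\gamma_2\ln\frac{6(K+1)}\beta}$. Then the choice $$2\gamma_2=\gamma_1=\frac1{160L\ln\frac{6(K+1)}\beta},\qquad m_1=m_2=\max\left\{1,\frac{81(K+1)\sigma^2}{640L^2R^2\ln\frac{6(K+1)}\beta}\right\}$$ satisfies the conditions $$\gamma_2+2\rho\le\gamma_1\le\frac1{160L\ln\frac{6(K+1)}\beta},\quad m_1\ge\max\left\{1,\frac{216\max\left\{\gamma_1\gamma_2(K+1),\sqrt{\gamma_1^3\gamma_2(K+1)}\ln\frac{6(K+1)}\beta\right\}\sigma^2}{R^2}\right\},$$ $$m_2\ge\max\left\{1,\frac{3240(K+1)\gamma_2^2\sigma^2\ln\frac{6(K+1)}\beta}{R^2}\right\},$$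 and with this choice the iterates produced by clipped-SEG after $K$ iterations satisfy with probability at least $1-\beta$ $$\frac1{K+1}\sum_{k=0}^K\|F(x^k)\|^2\le\frac{1843200\,L^2R^2\ln^2\frac{6(K+1)}\beta}{K+1}.$$ In particular, to guarantee $\frac1{K+1}\sum_{k=0}^K\|F(x^k)\|^2\le\varepsilon$ with probability at least $1-\beta$ for $\varepsilon>0$, clipped-SEG requires $O\left(\frac{L^2R^2}\varepsilon\ln^2\left(\frac{L^2R^2}{\varepsilon\beta}\right)\right)$ iterations and $$O\left(\max\left\{\frac{L^2R^2}\varepsilon\ln^2\left(\frac{L^2R^2}{\varepsilon\beta}\right),\frac{L^2\sigma^2R^2}{\varepsilon^2}\ln^3\left(\frac{L^2R^2}{\varepsilon\beta}\right)\right\}\right)\ \text{oracle calls}.$$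
   Context: Notation: $\|\cdot\|$ is the Euclidean norm, $B_r(x)=\{u\in\mathbb{R}^d:\|u-x\|\le r\}$. $F:\mathbb{R}^d\to\mathbb{R}^d$ with $F(x)=\mathbb{E}_{\xi\sim\mathcal D}[F_\xi(x)]$ for all $x$, where $F_\xi(x)$ is a stochastic oracle. $\mathcal X^*=\{x:F(x)=0\}$ is nonempty, $x^0$ is the starting point, and (except where quantified over all solutions) $x^*$ is the projection of $x^0$ onto $\mathcal X^*$. $\mathrm{clip}(y,\lambda)=\min\{1,\lambda/\|y\|\}y$ for $y\ne0$, $\mathrm{clip}(0,\lambda)=0$, for $\lambda>0$. clipped-SEG, for $k=0,1,\dots$: $\widetilde x^k=x^k-\gamma_1\widetilde F_{\boldsymbol\xi_1^k}(x^k)$, $x^{k+1}=x^k-\gamma_2\widetilde F_{\boldsymbol\xi_2^k}(\widetilde x^k)$, where $\widetilde F_{\boldsymbol\xi_1^k}(x^k)=\mathrm{clip}\left(\frac1{m_{1,k}}\sum_{i=1}^{m_{1,k}}F_{\xi_1^{i,k}}(x^k),\lambda_{1,k}\right)$, $\widetilde F_{\boldsymbol\xi_2^k}(\widetilde x^k)=\mathrm{clip}\left(\frac1{m_{2,k}}\sum_{i=1}^{m_{2,k}}F_{\xi_2^{i,k}}(\widetilde x^k),\lambda_{2,k}\right)$ and all $\xi_1^{i,k},\xi_2^{i,k}$ are independent samples from $\mathcal D$. Clipping levels are positive (so $R>0$); batchsizes are positive integers (a non-integer prescribed batchsize is rounded up). An oracle call is one evaluation of some $F_\xi(x)$; the total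 number of oracle calls is $(m_1+m_2)(K+1)$. "Requires $O(N)$ iterations (oracle calls)" means that there is a $K$ for which the stated choice of parameters (with $\rho$ satisfying the displayed bound for that $K$) gives the guarantee with at most $O(N)$ iterations (oracle calls), where $O(\cdot)$ hides absolute constants; these bounds are understood for $\varepsilon$ small enough that the arguments of the logarithms are at least 2.
   Formalization: The oracle-call bound is proved only for ε ≤ L²R²; without this it fails (σ=0, L²R²/ε=2β, β→0: at least 2 calls are made but the bound tends to 0). The iteration bound and the guarantee are proved without this restriction. *)

theory Defs
  imports "HOL-Probability.Probability"
begin

section \<open>The algorithm\<close>

definition clip :: "'a::euclidean_space \<Rightarrow> real \<Rightarrow> 'a" where
  "clip y l = (if y = 0 then 0 else min 1 (l / norm y) *\<^sub>R y)"

text \<open>Here \<open>G s x\<close> is the oracle answer \<open>F_s(x)\<close>, and \<open>s 1, \<dots>, s m\<close> are the samples of the batch.\<close>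

definition batch_mean :: "('s \<Rightarrow> 'a::euclidean_space \<Rightarrow> 'a) \<Rightarrow> nat \<Rightarrow> (nat \<Rightarrow> 's) \<Rightarrow> 'a \<Rightarrow> 'a" where
  "batch_mean G m s x = (1 / real m) *\<^sub>R (\<Sum>i=1..m. G (s i) x)"

text \<open>
  The iterates for one fixed realisation of the samples: \<open>s1 k i\<close> and \<open>s2 k i\<close> are the
  \<open>i\<close>-th samples used in iteration \<open>k\<close> in the extrapolation and in the update step.
\<close>

primrec clipped_SEG ::
  "('s \<Rightarrow> 'a::euclidean_space \<Rightarrow> 'a) \<Rightarrow> real \<Rightarrow> real \<Rightarrow> (nat \<Rightarrow> real) \<Rightarrow> (nat \<Rightarrow> real) \<Rightarrow>
   (nat \<Rightarrow> nat) \<Rightarrow> (nat \<Rightarrow> nat) \<Rightarrow> (nat \<Rightarrow> nat \<Rightarrow> 's) \<Rightarrow> (nat \<Rightarrow> nat \<Rightarrow> 's) \<Rightarrow> 'a \<Rightarrow> nat \<Rightarrow> 'a" where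
  "clipped_SEG G \<gamma>1 \<gamma>2 lam1 lam2 m1 m2 s1 s2 x0 0 = x0"
| "clipped_SEG G \<gamma>1 \<gamma>2 lam1 lam2 m1 m2 s1 s2 x0 (Suc k) =
     (let x = clipped_SEG G \<gamma>1 \<gamma>2 lam1 lam2 m1 m2 s1 s2 x0 k;
          x' = x - \<gamma>1 *\<^sub>R clip (batch_mean G (m1 k) (s1 k) x) (lam1 k)
      in x - \<gamma>2 *\<^sub>R clip (batch_mean G (m2 k) (s2 k) x') (lam2 k))"

text \<open>
  \<open>\<xi> j k i\<close> (with \<open>j = 1, 2\<close>) is the random variable \<open>\<xi>_j^{i,k}\<close>; \<open>m j k\<close> is the batchsize
  \<open>m_{j,k}\<close>. All samples that are drawn are jointly independent and have distribution \<open>D\<close>.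
\<close>

definition iid_samples ::
  "'w measure \<Rightarrow> 's measure \<Rightarrow> (nat \<Rightarrow> nat \<Rightarrow> nat) \<Rightarrow> (nat \<Rightarrow> nat \<Rightarrow> nat \<Rightarrow> 'w \<Rightarrow> 's) \<Rightarrow> bool" where
  "iid_samples M D m \<xi> \<longleftrightarrow>
     prob_space M \<and>
     prob_space.indep_vars M (\<lambda>_. D) (\<lambda>(j, k, i). \<xi> j k i)
       {(j, k, i). j \<in> {1, 2} \<and> i \<in> {1..m j k}} \<and>
     (\<forall>j\<in>{1, 2}. \<forall>k. \<forall>i\<in>{1..m j k}. distr M D (\<xi> j k i) = D)"

section \<open>The problem class\<close>

definition solutions :: "('a::euclidean_space \<Rightarrow> 'a) \<Rightarrow> 'a set" where
  "solutions F = {x. F x = 0}"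

text \<open>
  Joint measurability of the oracle is what makes the iterates random variables.
  \<open>projection\<close> says that \<open>xs\<close> is a solution closest to \<open>x0\<close> (no uniqueness is assumed).
\<close>

locale SEG_problem =
  fixes D :: "'s measure" and G :: "'s \<Rightarrow> 'a::euclidean_space \<Rightarrow> 'a" and F :: "'a \<Rightarrow> 'a"
    and x0 xs :: 'a and R L \<sigma> \<rho> :: real
  assumes prob_D: "prob_space D"
    and oracle_measurable: "(\<lambda>(s, x). G s x) \<in> borel_measurable (D \<Otimes>\<^sub>M borel)"
    and oracle_integrable: "\<And>x. integrable D (\<lambda>s. G s x)"
    and oracle_mean: "\<And>x. F x = (\<integral>s. G s x \<partial>D)"
    and projection: "xs \<in> solutions F" "\<And>z. z \<in> solutions F \<Longrightarrow> dist x0 xs \<le> dist x0 z"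
    and R_pos: "0 < R" and R_ge: "norm (x0 - xs) \<le> R"
    and L_pos: "0 < L"
    and variance_integrable:
      "\<And>x. x \<in> cball xs (3 * R) \<Longrightarrow> integrable D (\<lambda>s. (norm (G s x - F x))\<^sup>2)"
    and variance_le:
      "\<And>x. x \<in> cball xs (3 * R) \<Longrightarrow> (\<integral>s. (norm (G s x - F x))\<^sup>2 \<partial>D) \<le> \<sigma>\<^sup>2"
    and lipschitz:
      "\<And>x y. x \<in> cball xs (3 * R) \<Longrightarrow> y \<in> cball xs (3 * R) \<Longrightarrow> norm (F x - F y) \<le> L * norm (x - y)"
    and \<rho>_nonneg: "0 \<le> \<rho>"
    and star_negative_comonotone:
      "\<And>z x. z \<in> solutions F \<Longrightarrow> x \<in> cball xs (3 * R) \<Longrightarrow> F x \<bullet> (x - z) \<ge> - \<rho> * (norm (F x))\<^sup>2"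

section \<open>The prescribed parameters\<close>

definition log_factor :: "real \<Rightarrow> nat \<Rightarrow> real" where
  "log_factor \<beta> K = ln (6 * (real K + 1) / \<beta>)"

definition step1 :: "real \<Rightarrow> real \<Rightarrow> nat \<Rightarrow> real" where
  "step1 L \<beta> K = 1 / (160 * L * log_factor \<beta> K)"

definition step2 :: "real \<Rightarrow> real \<Rightarrow> nat \<Rightarrow> real" where
  "step2 L \<beta> K = step1 L \<beta> K / 2"

definition clip_level :: "real \<Rightarrow> real \<Rightarrow> real \<Rightarrow> nat \<Rightarrow> real" where
  "clip_level R \<gamma> \<beta> K = R / (20 * \<gamma> * log_factor \<beta> K)"

definition batchsize :: "real \<Rightarrow> real \<Rightarrow> real \<Rightarrow> real \<Rightarrow> nat \<Rightarrow> nat" where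
  "batchsize L R \<sigma> \<beta> K =
     nat \<lceil>max 1 (81 * (real K + 1) * \<sigma>\<^sup>2 / (640 * L\<^sup>2 * R\<^sup>2 * log_factor \<beta> K))\<rceil>"

text \<open>The random iterates of clipped-SEG with these parameters, at the outcome \<open>\<omega>\<close>.\<close>

definition prescribed_SEG ::
  "('s \<Rightarrow> 'a::euclidean_space \<Rightarrow> 'a) \<Rightarrow> 'a \<Rightarrow> (nat \<Rightarrow> nat \<Rightarrow> nat \<Rightarrow> 'w \<Rightarrow> 's) \<Rightarrow>
   real \<Rightarrow> real \<Rightarrow> real \<Rightarrow> real \<Rightarrow> nat \<Rightarrow> 'w \<Rightarrow> nat \<Rightarrow> 'a" where
  "prescribed_SEG G x0 \<xi> L R \<sigma> \<beta> K \<omega> =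
     clipped_SEG G (step1 L \<beta> K) (step2 L \<beta> K)
       (\<lambda>_. clip_level R (step1 L \<beta> K) \<beta> K) (\<lambda>_. clip_level R (step2 L \<beta> K) \<beta> K)
       (\<lambda>_. batchsize L R \<sigma> \<beta> K) (\<lambda>_. batchsize L R \<sigma> \<beta> K)
       (\<lambda>k i. \<xi> 1 k i \<omega>) (\<lambda>k i. \<xi> 2 k i \<omega>) x0"

definition mean_sq_residual :: "('a::euclidean_space \<Rightarrow> 'a) \<Rightarrow> (nat \<Rightarrow> 'a) \<Rightarrow> nat \<Rightarrow> real" where
  "mean_sq_residual F x K = (1 / (real K + 1)) * (\<Sum>k=0..K. (norm (F (x k)))\<^sup>2)"

text \<open>
  The absolute constant hidden in \<open>O(\<cdot>)\<close>. It is a numeral, not existentially quantified in the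
  theorem: an existential there would sit below the (outermost, implicit) quantification over
  types, so the constant could depend on the dimension and on the sample space.
  The value is deliberately far from tight.
\<close>

definition O_const :: real where
  "O_const = 10 ^ 30"

end

theory Submission
  imports Defs
begin

text \<open>
  Let \<open>l = ln (6 (K + 1) / \<beta>)\<close> and \<open>V k = \<parallel>x k - x*\<parallel>\<^sup>2 + \<gamma>1 \<gamma>2 / 9 * (\<Sum>j<k. \<parallel>F (x j)\<parallel>\<^sup>2)\<close>. The extragradient
  inequality bounds the increment of \<open>V\<close> by terms that are linear and quadratic in the noise of the two
  clipped batches. As long as \<open>\<parallel>x k - x*\<parallel> \<le> 2 R\<close>, clipping bounds these terms after multiplication with
  \<open>l / R\<^sup>2\<close>, so that \<open>exp z \<le> 1 + z + z\<^sup>2\<close> controls their exponential moment by the bias and the variance of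
  the clipped batch means; with the prescribed batchsizes the expectation of \<open>exp (l V / R\<^sup>2)\<close> grows by at
  most the factor \<open>exp (l / (2 (K + 1)))\<close> per step. Frozen at the first time when \<open>V > 4 R\<^sup>2\<close>, the process
  thus has exponential moment at most \<open>exp (3 l / 2)\<close> after \<open>K + 1\<close> steps, while its value is at least \<open>exp (4 l)\<close>
  if it was ever frozen. By Markov's inequality this has probability at most \<open>exp (- l) \<le> \<beta>\<close>, and otherwise
  \<open>V (K + 1) \<le> 4 R\<^sup>2\<close>, which is the asserted bound.
\<close>

section \<open>Clipped random vectors\<close>

text \<open>On \<open>[0, 1]\<close> this is the standard bound; for \<open>x = - y < 0\<close> it
  follows from \<open>exp (- y) \<le> 1 / (1 + y)\<close>.\<close>

lemma exp_le_quadratic: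
  fixes x :: real
  assumes "x \<le> 1"
  shows "exp x \<le> 1 + x + x\<^sup>2"
proof (cases "0 \<le> x")
  case True
  then show ?thesis using assms by (rule exp_bound)
next
  case False
  define y where "y = - x"
  have y: "0 < y" using False by (simp add: y_def)
  have "exp x * (1 + y) \<le> exp x * exp y"
    using exp_ge_add_one_self[of y] by (intro mult_left_mono) auto
  also have "\<dots> = 1" by (simp add: y_def flip: exp_add)
  \<comment> \<open>The product equals \<open>1 + y ^ 3\<close>.\<close>
  also have "1 \<le> (1 + x + x\<^sup>2) * (1 + y)"
    using zero_le_power[of y 3] y
    by (simp add: y_def algebra_simps power2_eq_square power3_eq_cube)
  finally show ?thesis using y by (simp add: mult_le_cancel_right)
qed

lemma norm_clip_le: "0 \<le> l \<Longrightarrow> norm (clip y l) \<le> l"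
  by (auto simp: clip_def min_def field_simps)

text \<open>Clipping is the metric projection onto the ball of radius \<open>l\<close>, so it moves
  \<open>y\<close> by exactly the excess of its norm.\<close>

lemma norm_diff_clip:
  assumes l: "0 \<le> l"
  shows "norm (y - clip y l) = max 0 (norm y - l)"
proof (cases "norm y \<le> l")
  case True
  then have "clip y l = y" by (cases "y = 0") (simp_all add: clip_def min_absorb1)
  then show ?thesis using True by simp
next
  case False
  then have y: "y \<noteq> 0" "0 < norm y" "l < norm y" using l by auto
  then have "l / norm y \<le> 1" by simp
  then have "y - clip y l = (1 - l / norm y) *\<^sub>R y"
    using y by (simp add: clip_def min_absorb2 scaleR_diff_left)
  then have "norm (y - clip y l) = (1 - l / norm y) * norm y"
    using \<open>l / norm y \<le> 1\<close> by simp
  also have "\<dots> = norm y - l" using y by (simp add: left_diff_distrib)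
  finally show ?thesis using y by simp
qed

lemma measurable_clip [measurable]: "(\<lambda>y. clip y l) \<in> borel_measurable borel"
  unfolding clip_def by measurable

text \<open>Independence turns the joint law into a product law, to which Tonelli applies. This
  takes the place of conditional expectations below: \<open>X\<close> is frozen while
  \<open>Y\<close> is integrated out.\<close>

lemma (in prob_space) nn_integral_indep_var:
  assumes ind: "indep_var S X T Y" and f [measurable]: "f \<in> borel_measurable (S \<Otimes>\<^sub>M T)"
  shows "(\<integral>\<^sup>+\<omega>. f (X \<omega>, Y \<omega>) \<partial>M) = (\<integral>\<^sup>+\<omega>. (\<integral>\<^sup>+\<omega>'. f (X \<omega>, Y \<omega>') \<partial>M) \<partial>M)"
proof -
  note X [measurable] = indep_var_rv1[OF ind] and Y [measurable] = indep_var_rv2[OF ind]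
  interpret Y: prob_space "distr M T Y" by (rule prob_space_distr[OF Y])
  have "(\<integral>\<^sup>+\<omega>. f (X \<omega>, Y \<omega>) \<partial>M) = (\<integral>\<^sup>+z. f z \<partial>distr M (S \<Otimes>\<^sub>M T) (\<lambda>\<omega>. (X \<omega>, Y \<omega>)))"
    by (subst nn_integral_distr) auto
  also have "\<dots> = (\<integral>\<^sup>+z. f z \<partial>(distr M S X \<Otimes>\<^sub>M distr M T Y))"
    using ind by (simp add: indep_var_distribution_eq)
  also have "\<dots> = (\<integral>\<^sup>+x. (\<integral>\<^sup>+y. f (x, y) \<partial>distr M T Y) \<partial>distr M S X)"
    by (rule Y.nn_integral_fst[symmetric]) simp
  also have "\<dots> = (\<integral>\<^sup>+\<omega>. (\<integral>\<^sup>+y. f (X \<omega>, y) \<partial>distr M T Y) \<partial>M)"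
    by (subst nn_integral_distr) auto
  also have "\<dots> = (\<integral>\<^sup>+\<omega>. (\<integral>\<^sup>+\<omega>'. f (X \<omega>, Y \<omega>') \<partial>M) \<partial>M)"
    by (intro nn_integral_cong, subst nn_integral_distr) auto
  finally show ?thesis .
qed

text \<open>Clipping makes \<open>W\<close> bounded, and \<open>small\<close> then keeps the
  exponent below 1, where \<open>exp\<close> has a quadratic upper bound. In expectation the linear
  noise vanishes, and the clipping bias and the quadratic terms are controlled by the second moment
  of the noise alone.\<close>

lemma (in prob_space) clipped_noise_mgf:
  fixes \<eta> :: "'a \<Rightarrow> 'b::euclidean_space" and f u :: 'b and v l q :: real
  assumes int: "integrable M \<eta>" and mean: "(\<integral>\<omega>. \<eta> \<omega> \<partial>M) = 0"
    and int2: "integrable M (\<lambda>\<omega>. (norm (\<eta> \<omega>))\<^sup>2)" and var: "(\<integral>\<omega>. (norm (\<eta> \<omega>))\<^sup>2 \<partial>M) \<le> v"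
    and l: "0 < l" and f: "norm f \<le> l / 2" and q: "0 \<le> q"
    and small: "2 * l * norm u + 4 * l\<^sup>2 * q \<le> 1"
  defines "W \<equiv> \<lambda>\<omega>. f - clip (f + \<eta> \<omega>) l"
  shows "(\<integral>\<^sup>+\<omega>. ennreal (exp (u \<bullet> W \<omega> + q * (norm (W \<omega>))\<^sup>2)) \<partial>M)
    \<le> ennreal (exp ((norm u / (2 * l) + 4 * q + 4 * (norm u + 2 * l * q)\<^sup>2) * v))"
proof -
  have [measurable]: "\<eta> \<in> borel_measurable M" using int by simp
  define C where "C = norm u / (2 * l) + 4 * q + 4 * (norm u + 2 * l * q)\<^sup>2"
  have C: "0 \<le> C" using l q by (auto simp: C_def)
  have W_l: "norm (W \<omega>) \<le> 2 * l" for \<omega>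
  proof -
    have "norm (W \<omega>) \<le> norm f + norm (clip (f + \<eta> \<omega>) l)" unfolding W_def by (rule norm_triangle_ineq4)
    then show ?thesis using f norm_clip_le[of l "f + \<eta> \<omega>"] l by simp
  qed
  have decomp: "W \<omega> = - \<eta> \<omega> + ((f + \<eta> \<omega>) - clip (f + \<eta> \<omega>) l)" for \<omega> by (simp add: W_def)
  \<comment> \<open>Because \<open>norm f \<le> l / 2\<close>, clipping acts only if the noise
    itself exceeds \<open>l / 2\<close>.\<close>
  have excess: "max 0 (norm (f + \<eta> \<omega>) - l) \<le> max 0 (norm (\<eta> \<omega>) - l / 2)" for \<omega>
    using f norm_triangle_ineq[of f "\<eta> \<omega>"] by auto
  have W_\<eta>: "norm (W \<omega>) \<le> 2 * norm (\<eta> \<omega>)" for \<omega>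
  proof -
    have "norm (W \<omega>) \<le> norm (\<eta> \<omega>) + max 0 (norm (f + \<eta> \<omega>) - l)"
      using norm_triangle_ineq[of "- \<eta> \<omega>" "(f + \<eta> \<omega>) - clip (f + \<eta> \<omega>) l"] l
      unfolding decomp by (simp add: norm_diff_clip)
    moreover have "max 0 (norm (f + \<eta> \<omega>) - l) \<le> norm (\<eta> \<omega>)"
      using f l norm_triangle_ineq[of f "\<eta> \<omega>"] by auto
    ultimately show ?thesis by linarith
  qed
  have bias: "u \<bullet> W \<omega> \<le> - (u \<bullet> \<eta> \<omega>) + norm u / (2 * l) * (norm (\<eta> \<omega>))\<^sup>2" for \<omega>
  proof -
    \<comment> \<open>For a positive excess this is
      \<open>(norm (\<eta> \<omega>) - l)\<^sup>2 \<ge> 0\<close> rearranged; it makes the clipping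
      bias quadratic in the noise.\<close>
    have "max 0 (norm (\<eta> \<omega>) - l / 2) \<le> (norm (\<eta> \<omega>))\<^sup>2 / (2 * l)"
      using l sum_squares_ge_zero[of "norm (\<eta> \<omega>) - l" 0]
      by (auto simp: max_def field_simps power2_eq_square)
    moreover have "u \<bullet> ((f + \<eta> \<omega>) - clip (f + \<eta> \<omega>) l) \<le> norm u * max 0 (norm (f + \<eta> \<omega>) - l)"
      using norm_cauchy_schwarz[of u "(f + \<eta> \<omega>) - clip (f + \<eta> \<omega>) l"] l by (simp only: norm_diff_clip less_imp_le)
    moreover have "norm u * max 0 (norm (f + \<eta> \<omega>) - l) \<le> norm u / (2 * l) * (norm (\<eta> \<omega>))\<^sup>2"
      using mult_left_mono[OF order_trans[OF excess[of \<omega>] calculation(1)] norm_ge_zero[of u]] by simp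
    moreover have "u \<bullet> W \<omega> = - (u \<bullet> \<eta> \<omega>) + u \<bullet> ((f + \<eta> \<omega>) - clip (f + \<eta> \<omega>) l)"
      by (subst decomp) (simp only: inner_add_right inner_minus_right)
    ultimately show ?thesis by linarith
  qed
  define X where "X \<omega> = u \<bullet> W \<omega> + q * (norm (W \<omega>))\<^sup>2" for \<omega>
  have [measurable]: "X \<in> borel_measurable M" unfolding X_def W_def by measurable
  have abs_X: "\<bar>X \<omega>\<bar> \<le> (norm u + 2 * l * q) * norm (W \<omega>)" for \<omega>
  proof -
    have "q * (norm (W \<omega>))\<^sup>2 \<le> q * (2 * l * norm (W \<omega>))"
      using W_l[of \<omega>] q by (intro mult_left_mono) (auto simp: power2_eq_square intro: mult_right_mono)
    then show ?thesis
      using Cauchy_Schwarz_ineq2[of u "W \<omega>"] q abs_triangle_ineq[of "u \<bullet> W \<omega>" "q * (norm (W \<omega>))\<^sup>2"]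
      by (simp add: X_def algebra_simps)
  qed
  have X_le_1: "X \<omega> \<le> 1" for \<omega>
  proof -
    have "\<bar>X \<omega>\<bar> \<le> (norm u + 2 * l * q) * (2 * l)"
      using l q by (intro order_trans[OF abs_X] mult_left_mono W_l) auto
    also have "\<dots> \<le> 1" using small by (simp add: algebra_simps power2_eq_square)
    finally show ?thesis by simp
  qed
  \<comment> \<open>The term \<open>u \<bullet> \<eta> \<omega>\<close> is kept without absolute
    value, since its mean is zero.\<close>
  have pointwise: "exp (X \<omega>) \<le> 1 - u \<bullet> \<eta> \<omega> + C * (norm (\<eta> \<omega>))\<^sup>2" for \<omega>
  proof -
    have W2: "(norm (W \<omega>))\<^sup>2 \<le> 4 * (norm (\<eta> \<omega>))\<^sup>2"
      using power_mono[OF W_\<eta>[of \<omega>], of 2] by (simp add: power_mult_distrib)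
    have "(X \<omega>)\<^sup>2 \<le> ((norm u + 2 * l * q) * norm (W \<omega>))\<^sup>2"
      using abs_X[of \<omega>] by (metis abs_ge_zero power2_abs power_mono)
    also have "\<dots> \<le> 4 * (norm u + 2 * l * q)\<^sup>2 * (norm (\<eta> \<omega>))\<^sup>2"
      unfolding power_mult_distrib[of _ "norm (W \<omega>)"]
      using mult_left_mono[OF W2, of "(norm u + 2 * l * q)\<^sup>2"] by (simp add: mult_ac)
    finally have "X \<omega> + (X \<omega>)\<^sup>2 \<le> - (u \<bullet> \<eta> \<omega>) + C * (norm (\<eta> \<omega>))\<^sup>2"
      using bias[of \<omega>] mult_left_mono[OF W2 q] by (simp add: X_def C_def algebra_simps)
    then show ?thesis using exp_le_quadratic[OF X_le_1[of \<omega>]] by simp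
  qed
  have int_rhs: "integrable M (\<lambda>\<omega>. 1 - u \<bullet> \<eta> \<omega> + C * (norm (\<eta> \<omega>))\<^sup>2)"
    using int int2 by (intro Bochner_Integration.integrable_add Bochner_Integration.integrable_diff integrable_mult_right) auto
  have "(\<integral>\<omega>. 1 - u \<bullet> \<eta> \<omega> + C * (norm (\<eta> \<omega>))\<^sup>2 \<partial>M) = 1 + C * (\<integral>\<omega>. (norm (\<eta> \<omega>))\<^sup>2 \<partial>M)"
    using int int2 mean by (simp add: prob_space)
  also have "\<dots> \<le> exp (C * v)"
    using mult_left_mono[OF var C] exp_ge_add_one_self[of "C * v"] by linarith
  finally have expectation: "(\<integral>\<omega>. 1 - u \<bullet> \<eta> \<omega> + C * (norm (\<eta> \<omega>))\<^sup>2 \<partial>M) \<le> exp (C * v)" .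
  have "(\<integral>\<^sup>+\<omega>. ennreal (exp (X \<omega>)) \<partial>M) \<le> (\<integral>\<^sup>+\<omega>. ennreal (1 - u \<bullet> \<eta> \<omega> + C * (norm (\<eta> \<omega>))\<^sup>2) \<partial>M)"
    by (intro nn_integral_mono ennreal_leI pointwise)
  also have "\<dots> = ennreal (\<integral>\<omega>. 1 - u \<bullet> \<eta> \<omega> + C * (norm (\<eta> \<omega>))\<^sup>2 \<partial>M)"
    using order_trans[OF exp_ge_zero pointwise] by (intro nn_integral_eq_integral int_rhs) simp
  also have "\<dots> \<le> ennreal (exp (C * v))" using expectation by (rule ennreal_leI)
  finally show ?thesis by (simp only: X_def C_def)
qed

text \<open>Cross terms vanish because the summands are centred and pairwise independent.\<close>

lemma (in prob_space) second_moment_sum_indep: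
  fixes X :: "'i \<Rightarrow> 'a \<Rightarrow> 'b::euclidean_space"
  assumes ind: "indep_vars (\<lambda>_. borel) X I" and "finite I"
    and int: "\<And>i. i \<in> I \<Longrightarrow> integrable M (X i)" and mean: "\<And>i. i \<in> I \<Longrightarrow> (\<integral>\<omega>. X i \<omega> \<partial>M) = 0"
    and int2: "\<And>i. i \<in> I \<Longrightarrow> integrable M (\<lambda>\<omega>. (norm (X i \<omega>))\<^sup>2)"
    and var: "\<And>i. i \<in> I \<Longrightarrow> (\<integral>\<omega>. (norm (X i \<omega>))\<^sup>2 \<partial>M) \<le> s"
  shows "integrable M (\<lambda>\<omega>. (norm (\<Sum>i\<in>I. X i \<omega>))\<^sup>2)"
    and "(\<integral>\<omega>. (norm (\<Sum>i\<in>I. X i \<omega>))\<^sup>2 \<partial>M) \<le> real (card I) * s"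
proof -
  have cross: "integrable M (\<lambda>\<omega>. X i \<omega> \<bullet> X j \<omega>) \<and> (\<integral>\<omega>. X i \<omega> \<bullet> X j \<omega> \<partial>M) = 0"
    if "i \<in> I" "j \<in> I" "i \<noteq> j" for i j
  proof -
    have ij: "indep_var borel (X i) borel (X j)" (is ?indep)
    proof -
      have "indep_var (\<Pi>\<^sub>M i\<in>{i}. borel) (\<lambda>\<omega>. \<lambda>i\<in>{i}. X i \<omega>) (\<Pi>\<^sub>M j\<in>{j}. borel) (\<lambda>\<omega>. \<lambda>j\<in>{j}. X j \<omega>)"
        using that by (intro indep_var_restrict[OF ind]) auto
      from indep_var_compose[OF this, of "\<lambda>p. p i" borel "\<lambda>p. p j" borel] show ?indep
        by (simp add: comp_def)
    qed
    \<comment> \<open>Expectations of independent real factors multiply, so the inner product is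
      treated coordinate by coordinate.\<close>
    have b: "integrable M (\<lambda>\<omega>. (X i \<omega> \<bullet> b) * (X j \<omega> \<bullet> b)) \<and> (\<integral>\<omega>. (X i \<omega> \<bullet> b) * (X j \<omega> \<bullet> b) \<partial>M) = 0" for b
    proof -
      have "indep_var borel ((\<lambda>x. x \<bullet> b) \<circ> X i) borel ((\<lambda>x. x \<bullet> b) \<circ> X j)"
        by (rule indep_var_compose[OF ij]) auto
      then have "indep_var borel (\<lambda>\<omega>. X i \<omega> \<bullet> b) borel (\<lambda>\<omega>. X j \<omega> \<bullet> b)" by (simp add: comp_def)
      from indep_var_lebesgue_integral[OF this] indep_var_integrable[OF this] show ?thesis
        using int that mean by simp
    qed
    have "X i \<omega> \<bullet> X j \<omega> = (\<Sum>b\<in>Basis. (X i \<omega> \<bullet> b) * (X j \<omega> \<bullet> b))" for \<omega>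
      by (rule euclidean_inner)
    then show ?thesis using b by (simp add: Bochner_Integration.integral_sum)
  qed
  have sq: "(norm (\<Sum>i\<in>I. X i \<omega>))\<^sup>2 = (\<Sum>i\<in>I. \<Sum>j\<in>I. X i \<omega> \<bullet> X j \<omega>)" for \<omega>
    by (simp only: power2_norm_eq_inner inner_sum_left) (simp only: inner_sum_right)
  have pair: "integrable M (\<lambda>\<omega>. X i \<omega> \<bullet> X j \<omega>)" if "i \<in> I" "j \<in> I" for i j
    using cross[OF that] int2[OF that(1)] by (cases "i = j") (auto simp: power2_norm_eq_inner)
  show "integrable M (\<lambda>\<omega>. (norm (\<Sum>i\<in>I. X i \<omega>))\<^sup>2)"
    unfolding sq using pair by auto
  have "(\<integral>\<omega>. (norm (\<Sum>i\<in>I. X i \<omega>))\<^sup>2 \<partial>M) = (\<Sum>i\<in>I. \<Sum>j\<in>I. \<integral>\<omega>. X i \<omega> \<bullet> X j \<omega> \<partial>M)"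
    unfolding sq using pair by (simp add: Bochner_Integration.integral_sum)
  also have "\<dots> = (\<Sum>i\<in>I. \<Sum>j\<in>I. if j = i then (\<integral>\<omega>. (norm (X i \<omega>))\<^sup>2 \<partial>M) else 0)"
    using cross by (intro sum.cong refl) (auto simp: power2_norm_eq_inner)
  also have "\<dots> = (\<Sum>i\<in>I. \<integral>\<omega>. (norm (X i \<omega>))\<^sup>2 \<partial>M)"
    using \<open>finite I\<close> by simp
  also have "\<dots> \<le> real (card I) * s"
    using sum_bounded_above[of I, OF var] by simp
  finally show "(\<integral>\<omega>. (norm (\<Sum>i\<in>I. X i \<omega>))\<^sup>2 \<partial>M) \<le> real (card I) * s" .
qed

section \<open>Deterministic estimates\<close>

text \<open>Here \<open>d\<close> points from the solution to the current iterate, \<open>p\<close>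
  and \<open>q\<close> are the clipped estimates at the current and at the extrapolated point, and
  \<open>fx\<close>, \<open>fy\<close> are the exact values there. Comonotonicity at the
  extrapolated point bounds \<open>fy \<bullet> d\<close>; completing the square leaves
  \<open>(norm (p - fy))\<^sup>2 - (norm p)\<^sup>2\<close>, which the Lipschitz bound makes
  negative up to the noise \<open>fx - p\<close>.\<close>

lemma extragradient_descent:
  fixes d p q fx fy :: "'a::real_inner" and \<gamma>1 \<gamma>2 L \<rho> :: real
  assumes mono: "fy \<bullet> (d - \<gamma>1 *\<^sub>R p) \<ge> - \<rho> * (norm fy)\<^sup>2"
    and lip: "norm (fx - fy) \<le> L * norm (\<gamma>1 *\<^sub>R p)"
    and \<gamma>: "0 \<le> \<gamma>1" "0 \<le> \<gamma>2" "\<gamma>2 + 2 * \<rho> \<le> \<gamma>1" and L: "0 \<le> L" "L * \<gamma>1 \<le> 1 / 2"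
  shows "(norm (d - \<gamma>2 *\<^sub>R q))\<^sup>2 + \<gamma>1 * \<gamma>2 / 9 * (norm fx)\<^sup>2 \<le>
    (norm d)\<^sup>2 + 3 * \<gamma>1 * \<gamma>2 * (norm (fx - p))\<^sup>2
    + 2 * \<gamma>2 * ((d - \<gamma>2 *\<^sub>R fy) \<bullet> (fy - q)) + \<gamma>2\<^sup>2 * (norm (fy - q))\<^sup>2"
proof -
  have sq_sum: "(norm (a + b))\<^sup>2 \<le> 2 * (norm a)\<^sup>2 + 2 * (norm b)\<^sup>2" for a b :: 'a
    using zero_le_power2[of "norm (a - b)"]
    by (simp add: power2_norm_eq_inner inner_simps inner_commute)
  have "d - \<gamma>2 *\<^sub>R q = (d - \<gamma>2 *\<^sub>R fy) + \<gamma>2 *\<^sub>R (fy - q)" by (simp add: algebra_simps)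
  then have split: "(norm (d - \<gamma>2 *\<^sub>R q))\<^sup>2 = (norm (d - \<gamma>2 *\<^sub>R fy))\<^sup>2
      + 2 * \<gamma>2 * ((d - \<gamma>2 *\<^sub>R fy) \<bullet> (fy - q)) + \<gamma>2\<^sup>2 * (norm (fy - q))\<^sup>2"
    by (simp only: power2_norm_eq_inner)
      (simp add: inner_simps inner_commute power2_eq_square algebra_simps)
  have "(norm (d - \<gamma>2 *\<^sub>R fy))\<^sup>2 = (norm d)\<^sup>2 - 2 * \<gamma>2 * (fy \<bullet> d) + \<gamma>2\<^sup>2 * (norm fy)\<^sup>2"
    by (simp only: power2_norm_eq_inner)
      (simp add: inner_simps inner_commute power2_eq_square algebra_simps)
  also have "\<dots> \<le> (norm d)\<^sup>2 - 2 * \<gamma>2 * (\<gamma>1 * (fy \<bullet> p) - \<rho> * (norm fy)\<^sup>2) + \<gamma>2\<^sup>2 * (norm fy)\<^sup>2"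
    using mult_left_mono[of "\<gamma>1 * (fy \<bullet> p) - \<rho> * (norm fy)\<^sup>2" "fy \<bullet> d" "2 * \<gamma>2"] mono \<gamma>(2)
    by (simp add: inner_simps)
  also have "\<dots> = (norm d)\<^sup>2 - 2 * \<gamma>1 * \<gamma>2 * (fy \<bullet> p) + \<gamma>2 * (\<gamma>2 + 2 * \<rho>) * (norm fy)\<^sup>2"
    by (simp add: algebra_simps power2_eq_square)
  \<comment> \<open>The defect of monotonicity is absorbed by taking the extrapolation step longer
    than the update step.\<close>
  also have "\<gamma>2 * (\<gamma>2 + 2 * \<rho>) * (norm fy)\<^sup>2 \<le> \<gamma>1 * \<gamma>2 * (norm fy)\<^sup>2"
    using \<gamma> mult_left_mono[OF \<gamma>(3,2)] by (intro mult_right_mono) (auto simp: mult.commute)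
  finally have step: "(norm (d - \<gamma>2 *\<^sub>R fy))\<^sup>2 \<le> (norm d)\<^sup>2 + \<gamma>1 * \<gamma>2 * ((norm (p - fy))\<^sup>2 - (norm p)\<^sup>2)"
    by (simp add: power2_norm_eq_inner inner_simps inner_commute algebra_simps)
  have "norm (fx - fy) \<le> 1 / 2 * norm p"
    using lip \<gamma>(1) mult_right_mono[OF L(2), of "norm p"] by simp
  then have "(norm (fx - fy))\<^sup>2 \<le> (1 / 2 * norm p)\<^sup>2" by (intro power_mono) auto
  then have "(norm (p - fy))\<^sup>2 \<le> 2 * (norm (fx - p))\<^sup>2 + 1 / 2 * (norm p)\<^sup>2"
    using sq_sum[of "p - fx" "fx - fy"] by (simp add: power_mult_distrib power_divide norm_minus_commute)
  moreover have "(norm fx)\<^sup>2 \<le> 2 * (norm (fx - p))\<^sup>2 + 2 * (norm p)\<^sup>2"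
    using sq_sum[of "fx - p" p] by simp
  \<comment> \<open>With weight 1/9, the coefficient of \<open>(norm p)\<^sup>2\<close> is
    \<open>1/2 - 1 + 2/9 < 0\<close>, and that of the noise is
    \<open>2 + 2/9 \<le> 3\<close>.\<close>
  ultimately have "(norm (p - fy))\<^sup>2 - (norm p)\<^sup>2 + 1 / 9 * (norm fx)\<^sup>2 \<le> 3 * (norm (fx - p))\<^sup>2"
    using zero_le_power2[of "norm (fx - p)"] zero_le_power2[of "norm p"] by linarith
  then have "\<gamma>1 * \<gamma>2 * ((norm (p - fy))\<^sup>2 - (norm p)\<^sup>2 + 1 / 9 * (norm fx)\<^sup>2)
      \<le> \<gamma>1 * \<gamma>2 * (3 * (norm (fx - p))\<^sup>2)"
    using \<gamma> by (intro mult_left_mono) auto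
  then show ?thesis using split step by (simp add: algebra_simps)
qed

section \<open>Numerical bounds for the prescribed parameters\<close>

lemma one_le_ln_six: "1 \<le> ln (6::real)"
proof -
  have "exp 1 \<le> (6::real)" using exp_le by simp
  then show ?thesis by (simp add: ln_ge_iff)
qed

lemma log_factor_ge_1:
  assumes "0 < \<beta>" "\<beta> \<le> 1"
  shows "1 \<le> log_factor \<beta> K"
proof -
  have "6 * \<beta> \<le> 6 * (real K + 1)" using assms by simp
  then have "6 \<le> 6 * (real K + 1) / \<beta>" using assms by (simp add: le_divide_eq)
  then have "ln 6 \<le> log_factor \<beta> K" unfolding log_factor_def by simp
  then show ?thesis using one_le_ln_six by simp
qed

lemma batchsize_ge:
  "1 \<le> real (batchsize L R \<sigma> \<beta> K)"
  "81 * (real K + 1) * \<sigma>\<^sup>2 / (640 * L\<^sup>2 * R\<^sup>2 * log_factor \<beta> K) \<le> real (batchsize L R \<sigma> \<beta> K)"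
proof -
  have "max 1 (81 * (real K + 1) * \<sigma>\<^sup>2 / (640 * L\<^sup>2 * R\<^sup>2 * log_factor \<beta> K)) \<le> real (batchsize L R \<sigma> \<beta> K)"
    unfolding batchsize_def by linarith
  then show "1 \<le> real (batchsize L R \<sigma> \<beta> K)"
    "81 * (real K + 1) * \<sigma>\<^sup>2 / (640 * L\<^sup>2 * R\<^sup>2 * log_factor \<beta> K) \<le> real (batchsize L R \<sigma> \<beta> K)"
    by (simp_all only: max.bounded_iff)
qed

text \<open>
  Here \<open>P = L R\<close>, \<open>l\<close> is one of the two clipping levels \<open>8 P\<close> and \<open>16 P\<close>, and \<open>n\<close>, \<open>q\<close> bound the linear and
  the quadratic coefficient with which the noise of a half step enters the exponent.
\<close>

lemma exponent_bounds:
  fixes P n q l :: real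
  assumes P: "0 < P" and n: "0 \<le> n" "n \<le> 3 / (160 * P)" and q: "0 \<le> q" "q \<le> 3 / (51200 * P\<^sup>2)"
    and l: "8 * P \<le> l" "l \<le> 16 * P"
  shows "2 * l * n + 4 * l\<^sup>2 * q \<le> 1"
    and "n / (2 * l) + 4 * q + 4 * (n + 2 * l * q)\<^sup>2 \<le> 1 / (32 * P\<^sup>2)"
proof -
  have ln: "l * n \<le> 16 * P * (3 / (160 * P))" using assms by (intro mult_mono) auto
  have lq: "l * q \<le> 16 * P * (3 / (51200 * P\<^sup>2))" using assms by (intro mult_mono) auto
  have "l * (l * q) \<le> 16 * P * (16 * P * (3 / (51200 * P\<^sup>2)))" using assms by (intro mult_mono[OF _ lq]) auto
  \<comment> \<open>The two summands are at most 0.6 and 0.06.\<close>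
  then show "2 * l * n + 4 * l\<^sup>2 * q \<le> 1" using ln P by (simp add: power2_eq_square field_simps)
  have "n + 2 * (l * q) \<le> 3 / (160 * P) + 2 * (16 * P * (3 / (51200 * P\<^sup>2)))" using n lq by simp
  also have "\<dots> \<le> 1 / (45 * P)" using P by (simp add: power2_eq_square field_simps)
  finally have "(n + 2 * l * q)\<^sup>2 \<le> (1 / (45 * P))\<^sup>2"
    using assms by (intro power_mono) (auto simp: mult.assoc)
  moreover have "n / (2 * l) \<le> 3 / (160 * P) / (2 * (8 * P))" using assms by (intro frac_le) auto
  \<comment> \<open>The left side is below \<open>1 / (290 * P\<^sup>2)\<close>, so the slack is
    ample.\<close>
  moreover have "3 / (160 * P) / (2 * (8 * P)) + 4 * (3 / (51200 * P\<^sup>2)) + 4 * (1 / (45 * P))\<^sup>2 \<le> 1 / (32 * P\<^sup>2)"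
    using P by (simp add: power2_eq_square field_simps)
  ultimately show "n / (2 * l) + 4 * q + 4 * (n + 2 * l * q)\<^sup>2 \<le> 1 / (32 * P\<^sup>2)" using q by linarith
qed

section \<open>One step of the method\<close>

text \<open>The current point and the two batches are separate arguments, so that one can be frozen
  while another is integrated out.\<close>

definition seg_step ::
  "('s \<Rightarrow> 'a::euclidean_space \<Rightarrow> 'a) \<Rightarrow> real \<Rightarrow> real \<Rightarrow> real \<Rightarrow> real \<Rightarrow> nat \<Rightarrow> 'a \<Rightarrow> (nat \<Rightarrow> 's) \<Rightarrow> (nat \<Rightarrow> 's) \<Rightarrow> 'a" where
  "seg_step G \<gamma>1 \<gamma>2 l1 l2 m x s1 s2 =
     x - \<gamma>2 *\<^sub>R clip (batch_mean G m s2 (x - \<gamma>1 *\<^sub>R clip (batch_mean G m s1 x) l1)) l2"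

locale SEG_run = SEG_problem D G F x0 xs R L \<sigma> \<rho> + prob_space M
  for D :: "'s measure" and G :: "'s \<Rightarrow> 'a::euclidean_space \<Rightarrow> 'a" and F x0 xs R L \<sigma> \<rho>
    and M :: "'w measure" +
  fixes K :: nat and \<beta> :: real and \<xi> :: "nat \<Rightarrow> nat \<Rightarrow> nat \<Rightarrow> 'w \<Rightarrow> 's"
  assumes \<beta>: "0 < \<beta>" "\<beta> \<le> 1" and \<rho>_le: "\<rho> \<le> 1 / (640 * L * log_factor \<beta> K)"
    and samples: "iid_samples M D (\<lambda>_ _. batchsize L R \<sigma> \<beta> K) \<xi>"
begin

abbreviation "ell \<equiv> log_factor \<beta> K"
abbreviation "g1 \<equiv> step1 L \<beta> K"
abbreviation "g2 \<equiv> step2 L \<beta> K"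
abbreviation "lam1 \<equiv> clip_level R g1 \<beta> K"
abbreviation "lam2 \<equiv> clip_level R g2 \<beta> K"
abbreviation "m \<equiv> batchsize L R \<sigma> \<beta> K"
text \<open>The scale gives \<open>c * R\<^sup>2 = ell\<close>: the start contributes at most
  \<open>exp ell\<close> and the threshold \<open>4 * R\<^sup>2\<close> exactly
  \<open>exp (4 * ell)\<close>.\<close>

abbreviation "c \<equiv> ell / R\<^sup>2"
abbreviation "step \<equiv> seg_step G g1 g2 lam1 lam2 m"

lemma ell_ge_1: "1 \<le> ell" using \<beta> by (rule log_factor_ge_1)

lemma g_pos: "0 < g1" "0 < g2"
  using ell_ge_1 L_pos by (auto simp: step1_def step2_def)

lemma g_eq: "g1 = 1 / (160 * L * ell)" "g2 = 1 / (320 * L * ell)"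
  by (auto simp: step1_def step2_def)

text \<open>The logarithm cancels between step size and clipping level. Both levels are at least
  twice \<open>3 * (L * R)\<close>, the bound of \<open>F\<close> on the ball of radius
  \<open>3 * R\<close>, as \<open>clipped_noise_mgf\<close> demands.\<close>

lemma lam_eq: "lam1 = 8 * (L * R)" "lam2 = 16 * (L * R)"
  using ell_ge_1 L_pos R_pos by (auto simp: clip_level_def g_eq field_simps)

lemma m_ge_1: "1 \<le> m"
  using batchsize_ge(1)[of L R \<sigma> \<beta> K] by simp

lemma batch_variance_le: "\<sigma>\<^sup>2 / real m \<le> 8 * (L * R)\<^sup>2 * ell / (real K + 1)"
proof -
  have "81 * (real K + 1) * \<sigma>\<^sup>2 / (640 * L\<^sup>2 * R\<^sup>2 * ell) \<le> real m"
    by (rule batchsize_ge(2))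
  then have "81 * ((real K + 1) * \<sigma>\<^sup>2) \<le> 640 * (real m * ((L * R)\<^sup>2 * ell))"
    using ell_ge_1 L_pos R_pos by (subst (asm) divide_le_eq) (auto simp: power_mult_distrib algebra_simps)
  moreover have "0 \<le> (real K + 1) * \<sigma>\<^sup>2" by simp
  \<comment> \<open>This rounds \<open>640 / 81 < 8\<close>.\<close>
  ultimately have "(real K + 1) * \<sigma>\<^sup>2 \<le> 8 * (real m * ((L * R)\<^sup>2 * ell))" by linarith
  then show ?thesis using m_ge_1 by (simp add: divide_le_eq le_divide_eq mult_ac)
qed

text \<open>Lipschitz continuity holds on the ball only; measurability on the whole space comes from
  \<open>F\<close> being a parameter integral of the jointly measurable oracle.\<close>

lemma F_measurable [measurable]: "F \<in> borel_measurable borel"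
proof -
  interpret D: prob_space D by (rule prob_D)
  have [measurable]: "(\<lambda>(x, s). G s x) \<in> borel_measurable (borel \<Otimes>\<^sub>M D)"
    using measurable_pair_swap[OF oracle_measurable] by (simp add: case_prod_beta')
  have "(\<lambda>x. \<integral>s. G s x \<partial>D) \<in> borel_measurable borel" by measurable
  then show ?thesis by (simp add: oracle_mean[abs_def])
qed

lemma F_norm_le: "norm (F x) \<le> L * norm (x - xs)" if "x \<in> cball xs (3 * R)"
  using lipschitz[OF that, of xs] projection(1) R_pos by (auto simp: solutions_def)

text \<open>The space \<open>N\<close> is arbitrary because the result is needed both on
  \<open>M\<close> and on products of sample spaces, where Tonelli is applied.\<close>

lemma measurable_batch_mean:
  assumes [measurable]: "x \<in> borel_measurable N" and s: "\<And>i. i \<in> {1..m} \<Longrightarrow> (\<lambda>\<omega>. s \<omega> i) \<in> measurable N D"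
  shows "(\<lambda>\<omega>. batch_mean G m (s \<omega>) (x \<omega>)) \<in> borel_measurable N"
proof -
  have [measurable]: "(\<lambda>\<omega>. G (s \<omega> i) (x \<omega>)) \<in> borel_measurable N" if "i \<in> {1..m}" for i
    using measurable_compose[OF measurable_Pair[OF s[OF that] assms(1)] oracle_measurable] by simp
  show ?thesis unfolding batch_mean_def by measurable
qed

lemma measurable_step:
  assumes [measurable]: "x \<in> borel_measurable N"
    and s: "\<And>i. i \<in> {1..m} \<Longrightarrow> (\<lambda>\<omega>. s1 \<omega> i) \<in> measurable N D" "\<And>i. i \<in> {1..m} \<Longrightarrow> (\<lambda>\<omega>. s2 \<omega> i) \<in> measurable N D"
  shows "(\<lambda>\<omega>. step (x \<omega>) (s1 \<omega>) (s2 \<omega>)) \<in> borel_measurable N"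
proof -
  note [measurable] = measurable_batch_mean[OF assms(1) s(1)]
  have [measurable]: "(\<lambda>\<omega>. x \<omega> - g1 *\<^sub>R clip (batch_mean G m (s1 \<omega>) (x \<omega>)) lam1) \<in> borel_measurable N"
    by measurable
  note [measurable] = measurable_batch_mean[OF this s(2)]
  show ?thesis unfolding seg_step_def by measurable
qed

text \<open>This allows a sample family to be replaced by its restriction to the index sets on which
  independence is stated.\<close>

lemma step_cong:
  assumes "\<And>i. i \<in> {1..m} \<Longrightarrow> s1 i = t1 i" "\<And>i. i \<in> {1..m} \<Longrightarrow> s2 i = t2 i"
  shows "step x s1 s2 = step x t1 t2"
proof -
  have "batch_mean G m s1 y = batch_mean G m t1 y" "batch_mean G m s2 y = batch_mean G m t2 y" for y
    using assms by (auto simp: batch_mean_def)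
  then show ?thesis by (simp add: seg_step_def)
qed

section \<open>Samples as one independent family, and the noise of a batch\<close>

definition batch :: "nat \<Rightarrow> nat \<Rightarrow> (nat \<times> nat \<times> nat) set" where
  "batch j k = {j} \<times> {k} \<times> {1..m}"

text \<open>Uncurrying the indices lets disjoint sets of triples yield independent blocks of
  samples.\<close>

definition sample :: "'w \<Rightarrow> nat \<times> nat \<times> nat \<Rightarrow> 's" where
  "sample \<omega> = (\<lambda>(j, k, i). \<xi> j k i \<omega>)"

lemma indep_samples:
  "indep_vars (\<lambda>_. D) (\<lambda>t \<omega>. sample \<omega> t) {(j, k, i). j \<in> {1, 2} \<and> i \<in> {1..m}}"
proof -
  have "(\<lambda>t \<omega>. sample \<omega> t) = (\<lambda>(j, k, i). \<xi> j k i)" by (auto simp: sample_def)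
  then show ?thesis using samples by (simp add: iid_samples_def)
qed

lemma measurable_sample: "j \<in> {1, 2} \<Longrightarrow> i \<in> {1..m} \<Longrightarrow> (\<lambda>\<omega>. sample \<omega> (j, k, i)) \<in> measurable M D"
  using indep_samples by (auto simp: indep_vars_def2)

lemma distr_sample: "j \<in> {1, 2} \<Longrightarrow> i \<in> {1..m} \<Longrightarrow> distr M D (\<lambda>\<omega>. sample \<omega> (j, k, i)) = D"
  using samples by (auto simp: iid_samples_def sample_def)

text \<open>At a deterministic point \<open>x\<close> the noise is an average of \<open>m\<close>
  independent centred vectors, which divides the variance by \<open>m\<close>. Random points are
  reached later by freezing them.\<close>

lemma batch_noise:
  fixes k :: nat
  assumes j: "j \<in> {1, 2}" and x: "x \<in> cball xs (3 * R)"
  defines "\<eta> \<equiv> \<lambda>\<omega>. batch_mean G m (\<lambda>i. sample \<omega> (j, k, i)) x - F x"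
  shows "integrable M \<eta>" "(\<integral>\<omega>. \<eta> \<omega> \<partial>M) = 0" "integrable M (\<lambda>\<omega>. (norm (\<eta> \<omega>))\<^sup>2)"
    "(\<integral>\<omega>. (norm (\<eta> \<omega>))\<^sup>2 \<partial>M) \<le> \<sigma>\<^sup>2 / real m"
proof -
  interpret D: prob_space D by (rule prob_D)
  have Gm [measurable]: "(\<lambda>s. G s x) \<in> borel_measurable D"
    using measurable_compose[OF measurable_Pair1'[of x borel D] measurable_pair_swap[OF oracle_measurable]]
    by simp
  define X where "X t \<omega> = G (sample \<omega> t) x - F x" for t \<omega>
  have [measurable]: "(\<lambda>\<omega>. sample \<omega> t) \<in> measurable M D" and distr: "distr M D (\<lambda>\<omega>. sample \<omega> t) = D"
    if "t \<in> batch j k" for t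
    using that j measurable_sample distr_sample by (auto simp: batch_def)
  have ind: "indep_vars (\<lambda>_. borel) X (batch j k)"
  proof -
    have "indep_vars (\<lambda>_. D) (\<lambda>t \<omega>. sample \<omega> t) (batch j k)"
      using j by (intro indep_vars_subset[OF indep_samples]) (auto simp: batch_def)
    from indep_vars_compose2[OF this, of "\<lambda>_ s. G s x - F x" "\<lambda>_. borel"] show ?thesis
      unfolding X_def by measurable
  qed
  \<comment> \<open>Each sample has law \<open>D\<close>, so moments of the oracle under
    \<open>D\<close> carry over to \<open>M\<close>.\<close>
  have transfer: "integrable M (\<lambda>\<omega>. f (sample \<omega> t))" "(\<integral>\<omega>. f (sample \<omega> t) \<partial>M) = (\<integral>s. f s \<partial>D)"
    if "t \<in> batch j k" "integrable D f" for t and f :: "'s \<Rightarrow> 'c::{banach, second_countable_topology}"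
    using that integrable_distr_eq[of "\<lambda>\<omega>. sample \<omega> t" M D f] integral_distr[of "\<lambda>\<omega>. sample \<omega> t" M D f]
      distr[OF that(1)] by auto
  have X_int: "integrable M (X t)" and X_mean: "(\<integral>\<omega>. X t \<omega> \<partial>M) = 0"
    and X_int2: "integrable M (\<lambda>\<omega>. (norm (X t \<omega>))\<^sup>2)" and X_var: "(\<integral>\<omega>. (norm (X t \<omega>))\<^sup>2 \<partial>M) \<le> \<sigma>\<^sup>2"
    if "t \<in> batch j k" for t
    using transfer[OF that, of "\<lambda>s. G s x - F x"] transfer[OF that, of "\<lambda>s. (norm (G s x - F x))\<^sup>2"]
      oracle_integrable[of x] oracle_mean[of x] variance_integrable[OF x] variance_le[OF x]
    by (auto simp: X_def[abs_def] D.prob_space)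
  have \<eta>: "\<eta> \<omega> = (1 / real m) *\<^sub>R (\<Sum>t\<in>batch j k. X t \<omega>)" for \<omega>
  proof -
    have "(\<Sum>t\<in>batch j k. X t \<omega>) = (\<Sum>i=1..m. X (j, k, i) \<omega>)"
      by (intro sum.reindex_bij_witness[of _ "\<lambda>i. (j, k, i)" "\<lambda>(j, k, i). i"]) (auto simp: batch_def)
    then show ?thesis
      using m_ge_1 by (simp add: \<eta>_def X_def batch_mean_def sum_subtractf scaleR_diff_right sum_constant_scaleR)
  qed
  have \<eta>2: "(norm (\<eta> \<omega>))\<^sup>2 = (1 / real m)\<^sup>2 * (norm (\<Sum>t\<in>batch j k. X t \<omega>))\<^sup>2" for \<omega>
    unfolding \<eta> by (simp add: power_mult_distrib power_divide)
  have "finite (batch j k)" "card (batch j k) = m" by (auto simp: batch_def card_cartesian_product)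
  note sum2 = second_moment_sum_indep[OF ind this(1) X_int X_mean X_int2 X_var, unfolded this(2)]
  show "integrable M \<eta>" unfolding \<eta> using X_int by auto
  show "(\<integral>\<omega>. \<eta> \<omega> \<partial>M) = 0" unfolding \<eta> using X_int X_mean by (simp add: Bochner_Integration.integral_sum)
  show "integrable M (\<lambda>\<omega>. (norm (\<eta> \<omega>))\<^sup>2)" unfolding \<eta>2 using sum2(1) by simp
  have "(\<integral>\<omega>. (norm (\<eta> \<omega>))\<^sup>2 \<partial>M) \<le> (1 / real m)\<^sup>2 * (real m * \<sigma>\<^sup>2)"
    unfolding \<eta>2 using mult_left_mono[OF sum2(2), of "(1 / real m)\<^sup>2"] by simp
  also have "\<dots> = \<sigma>\<^sup>2 / real m" using m_ge_1 by (simp add: power2_eq_square)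
  finally show "(\<integral>\<omega>. (norm (\<eta> \<omega>))\<^sup>2 \<partial>M) \<le> \<sigma>\<^sup>2 / real m" .
qed

text \<open>The allowance \<open>exp (ell / (2 * (real K + 1)))\<close> of a step is split evenly
  between its two batches; both use this bound, with different coefficients and clipping
  levels.\<close>

lemma batch_noise_mgf:
  assumes j: "j \<in> {1, 2}" and y: "y \<in> cball xs (3 * R)"
    and u: "norm u \<le> 3 / (160 * (L * R))" and q: "0 \<le> q" "q \<le> 3 / (51200 * (L * R)\<^sup>2)"
    and lam: "8 * (L * R) \<le> lam" "lam \<le> 16 * (L * R)"
  shows "(\<integral>\<^sup>+\<omega>. ennreal (exp (u \<bullet> (F y - clip (batch_mean G m (\<lambda>i. sample \<omega> (j, k, i)) y) lam)
      + q * (norm (F y - clip (batch_mean G m (\<lambda>i. sample \<omega> (j, k, i)) y) lam))\<^sup>2)) \<partial>M)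
    \<le> ennreal (exp (ell / (4 * (real K + 1))))"
proof -
  have P: "0 < L * R" using L_pos R_pos by simp
  note bounds = exponent_bounds[OF P norm_ge_zero u q lam]
  have "norm (F y) \<le> L * (3 * R)"
    using y L_pos F_norm_le[OF y] by (auto intro!: order_trans[OF F_norm_le[OF y]] mult_left_mono simp: dist_norm norm_minus_commute)
  then have Fy: "norm (F y) \<le> lam / 2" using lam P by simp
  have "0 < lam" using lam P by linarith
  note mgf = clipped_noise_mgf[OF batch_noise[OF j y] this Fy q(1) bounds(1)]
  \<comment> \<open>The factor 1/32 of \<open>exponent_bounds\<close> and the factor 8 of
    \<open>batch_variance_le\<close> give the 1/4.\<close>
  have "(norm u / (2 * lam) + 4 * q + 4 * (norm u + 2 * lam * q)\<^sup>2) * (\<sigma>\<^sup>2 / real m)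
      \<le> 1 / (32 * (L * R)\<^sup>2) * (8 * (L * R)\<^sup>2 * ell / (real K + 1))"
    using q lam P by (intro mult_mono bounds(2) batch_variance_le) auto
  also have "\<dots> = ell / (4 * (real K + 1))" using P L_pos R_pos by (simp add: field_simps)
  finally show ?thesis using mgf by (auto intro: order_trans ennreal_leI)
qed

text \<open>Once the first batch is frozen, the extrapolated point is deterministic and the second
  batch can be integrated out. What remains depends on the first batch only through
  \<open>norm (F x - p s1)\<close>, and is integrated next.\<close>

lemma one_step_mgf:
  assumes x: "norm (x - xs) \<le> 2 * R"
  shows "(\<integral>\<^sup>+\<omega>. ennreal (exp (c * ((norm (step x (\<lambda>i. sample \<omega> (1, k, i)) (\<lambda>i. sample \<omega> (2, k, i)) - xs))\<^sup>2
      + g1 * g2 / 9 * (norm (F x))\<^sup>2))) \<partial>M)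
    \<le> ennreal (exp (ell / (2 * (real K + 1))) * exp (c * (norm (x - xs))\<^sup>2))"
proof -
  define \<Phi> where "\<Phi> s1 s2 = exp (c * ((norm (step x s1 s2 - xs))\<^sup>2 + g1 * g2 / 9 * (norm (F x))\<^sup>2))" for s1 s2
  define p where "p s1 = clip (batch_mean G m s1 x) lam1" for s1
  define y where "y s1 = x - g1 *\<^sub>R p s1" for s1
  define e where "e s1 = (x - xs) - g2 *\<^sub>R F (y s1)" for s1
  define W where "W s1 s2 = F (y s1) - clip (batch_mean G m s2 (y s1)) lam2" for s1 s2
  have P: "0 < L * R" and c: "0 < c" using L_pos R_pos ell_ge_1 by auto
  have x_in: "x \<in> cball xs (3 * R)" using x R_pos by (simp add: dist_norm norm_minus_commute)
  \<comment> \<open>The clipped extrapolation has length at most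
    \<open>R / (20 * ell) \<le> R\<close>, so for every realisation it stays where the assumptions
    on \<open>F\<close> hold.\<close>
  have y_in: "y s1 \<in> cball xs (3 * R)" for s1
  proof -
    have "norm (p s1) \<le> lam1" unfolding p_def by (rule norm_clip_le) (use P lam_eq in simp)
    then have "g1 * norm (p s1) \<le> g1 * lam1" using g_pos by (intro mult_left_mono) auto
    also have "\<dots> = R / (20 * ell)" unfolding lam_eq using L_pos ell_ge_1 by (simp add: g_eq)
    also have "\<dots> \<le> R" using ell_ge_1 R_pos by (simp add: divide_le_eq)
    finally have "norm (g1 *\<^sub>R p s1) \<le> R" using g_pos by simp
    moreover have "y s1 - xs = (x - xs) - g1 *\<^sub>R p s1" by (simp add: y_def)
    then have "norm (y s1 - xs) \<le> norm (x - xs) + norm (g1 *\<^sub>R p s1)" by (simp only: norm_triangle_ineq4)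
    ultimately have "norm (y s1 - xs) \<le> 3 * R" using x by linarith
    then show ?thesis by (simp add: dist_norm norm_minus_commute)
  qed
  have Fy: "norm (F (y s1)) \<le> 3 * (L * R)" for s1
  proof -
    have "norm (F (y s1)) \<le> L * norm (y s1 - xs)" by (rule F_norm_le[OF y_in])
    also have "\<dots> \<le> L * (3 * R)"
      using y_in[of s1] L_pos by (intro mult_left_mono) (auto simp: dist_norm norm_minus_commute)
    finally show ?thesis by simp
  qed
  \<comment> \<open>The bound is \<open>2 * c * g2 * (3 * R)\<close>; the logarithms in
    \<open>c\<close> and \<open>g2\<close> cancel.\<close>
  have u: "norm ((2 * c * g2) *\<^sub>R e s1) \<le> 3 / (160 * (L * R))" for s1
  proof -
    have "g2 * norm (F (y s1)) \<le> g2 * (3 * (L * R))" using Fy g_pos by (intro mult_left_mono) auto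
    also have "\<dots> = 3 * R / (320 * ell)" using L_pos by (simp add: g_eq)
    also have "\<dots> \<le> R" using ell_ge_1 R_pos by (simp add: divide_le_eq)
    finally have "norm (e s1) \<le> 3 * R"
      using x norm_triangle_ineq4[of "x - xs" "g2 *\<^sub>R F (y s1)"] g_pos by (simp add: e_def)
    then have "(2 * c * g2) * norm (e s1) \<le> (2 * c * g2) * (3 * R)"
      using ell_ge_1 g_pos by (intro mult_left_mono) auto
    also have "\<dots> = 3 / (160 * (L * R))"
      using R_pos L_pos ell_ge_1 by (simp add: g_eq field_simps power2_eq_square)
    finally have "(2 * c * g2) * norm (e s1) \<le> 3 / (160 * (L * R))" .
    moreover have "0 \<le> 2 * c * g2" using ell_ge_1 g_pos by simp
    ultimately show ?thesis by (simp only: norm_scaleR abs_of_nonneg)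
  qed
  have q1: "0 \<le> 3 * c * g1 * g2" "3 * c * g1 * g2 \<le> 3 / (51200 * (L * R)\<^sup>2)"
    and q2: "0 \<le> c * g2\<^sup>2" "c * g2\<^sup>2 \<le> 3 / (51200 * (L * R)\<^sup>2)"
  proof -
    show "0 \<le> 3 * c * g1 * g2" "0 \<le> c * g2\<^sup>2" using ell_ge_1 g_pos by auto
    have "3 * c * g1 * g2 = 3 / (51200 * (L * R)\<^sup>2) / ell"
      using R_pos L_pos ell_ge_1 by (simp add: g_eq field_simps power2_eq_square)
    also have "\<dots> \<le> 3 / (51200 * (L * R)\<^sup>2) / 1" using ell_ge_1 by (intro divide_left_mono) auto
    finally show le: "3 * c * g1 * g2 \<le> 3 / (51200 * (L * R)\<^sup>2)" by simp
    have "c * g2 * g2 \<le> c * g2 * (3 * g1)"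
      using ell_ge_1 g_pos by (intro mult_left_mono) (auto simp: step2_def)
    also have "\<dots> = 3 * c * g1 * g2" by (simp only: mult_ac)
    finally show "c * g2\<^sup>2 \<le> 3 / (51200 * (L * R)\<^sup>2)" using le by (simp only: power2_eq_square mult.assoc)
  qed
  have descent: "\<Phi> s1 s2 \<le> exp (c * (norm (x - xs))\<^sup>2 + 3 * c * g1 * g2 * (norm (F x - p s1))\<^sup>2)
      * exp (((2 * c * g2) *\<^sub>R e s1) \<bullet> W s1 s2 + c * g2\<^sup>2 * (norm (W s1 s2))\<^sup>2)" for s1 s2
  proof -
    \<comment> \<open>The assumed bound on \<open>\<rho>\<close> equals
      \<open>g2 / 2\<close>.\<close>
    have "2 * \<rho> \<le> g2"
      using \<rho>_le by (simp add: g_eq)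
    then have \<gamma>: "g2 + 2 * \<rho> \<le> g1" by (simp add: step2_def)
    have L\<gamma>: "L * g1 \<le> 1 / 2" using L_pos ell_ge_1 by (simp add: g_eq)
    have y_xs: "y s1 - xs = (x - xs) - g1 *\<^sub>R p s1" and x_y: "x - y s1 = g1 *\<^sub>R p s1"
      by (auto simp: y_def)
    have step_eq: "step x s1 s2 - xs = (x - xs) - g2 *\<^sub>R clip (batch_mean G m s2 (y s1)) lam2"
      by (simp add: seg_step_def y_def p_def)
    have "(norm (step x s1 s2 - xs))\<^sup>2 + g1 * g2 / 9 * (norm (F x))\<^sup>2 \<le>
        (norm (x - xs))\<^sup>2 + 3 * g1 * g2 * (norm (F x - p s1))\<^sup>2
        + 2 * g2 * (e s1 \<bullet> W s1 s2) + g2\<^sup>2 * (norm (W s1 s2))\<^sup>2"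
      unfolding step_eq e_def W_def
      using star_negative_comonotone[OF projection(1) y_in[of s1]] lipschitz[OF x_in y_in[of s1]] g_pos L_pos
      by (intro extragradient_descent[where L = L and \<rho> = \<rho>] \<gamma> L\<gamma>) (simp_all only: y_xs x_y less_imp_le)
    then have "c * ((norm (step x s1 s2 - xs))\<^sup>2 + g1 * g2 / 9 * (norm (F x))\<^sup>2) \<le>
        c * ((norm (x - xs))\<^sup>2 + 3 * g1 * g2 * (norm (F x - p s1))\<^sup>2
        + 2 * g2 * (e s1 \<bullet> W s1 s2) + g2\<^sup>2 * (norm (W s1 s2))\<^sup>2)"
      using c by (intro mult_left_mono) auto
    then show ?thesis unfolding \<Phi>_def by (simp add: algebra_simps flip: exp_add)
  qed
  have W_meas: "(\<lambda>\<omega>. W s1 (\<lambda>i. sample \<omega> (2, k, i))) \<in> borel_measurable M" for s1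
  proof -
    have [measurable]: "(\<lambda>\<omega>. batch_mean G m (\<lambda>i. sample \<omega> (2, k, i)) (y s1)) \<in> borel_measurable M"
      by (intro measurable_batch_mean measurable_sample) auto
    show ?thesis unfolding W_def by measurable
  qed
  have [measurable]: "(\<lambda>\<omega>. p (\<lambda>i. sample \<omega> (1, k, i))) \<in> borel_measurable M"
  proof -
    have [measurable]: "(\<lambda>\<omega>. batch_mean G m (\<lambda>i. sample \<omega> (1, k, i)) x) \<in> borel_measurable M"
      by (intro measurable_batch_mean measurable_sample) auto
    show ?thesis unfolding p_def by measurable
  qed
  have second: "(\<integral>\<^sup>+\<omega>'. ennreal (\<Phi> s1 (\<lambda>i. sample \<omega>' (2, k, i))) \<partial>M)
      \<le> ennreal (exp (c * (norm (x - xs))\<^sup>2 + 3 * c * g1 * g2 * (norm (F x - p s1))\<^sup>2))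
        * ennreal (exp (ell / (4 * (real K + 1))))" for s1
  proof -
    note [measurable] = W_meas[of s1]
    have "(\<integral>\<^sup>+\<omega>'. ennreal (\<Phi> s1 (\<lambda>i. sample \<omega>' (2, k, i))) \<partial>M)
        \<le> (\<integral>\<^sup>+\<omega>'. ennreal (exp (c * (norm (x - xs))\<^sup>2 + 3 * c * g1 * g2 * (norm (F x - p s1))\<^sup>2))
          * ennreal (exp (((2 * c * g2) *\<^sub>R e s1) \<bullet> W s1 (\<lambda>i. sample \<omega>' (2, k, i))
              + c * g2\<^sup>2 * (norm (W s1 (\<lambda>i. sample \<omega>' (2, k, i))))\<^sup>2)) \<partial>M)"
      by (intro nn_integral_mono order_trans[OF ennreal_leI[OF descent]]) (simp add: ennreal_mult)
    also have "\<dots> = ennreal (exp (c * (norm (x - xs))\<^sup>2 + 3 * c * g1 * g2 * (norm (F x - p s1))\<^sup>2))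
          * (\<integral>\<^sup>+\<omega>'. ennreal (exp (((2 * c * g2) *\<^sub>R e s1) \<bullet> W s1 (\<lambda>i. sample \<omega>' (2, k, i))
              + c * g2\<^sup>2 * (norm (W s1 (\<lambda>i. sample \<omega>' (2, k, i))))\<^sup>2)) \<partial>M)"
      by (intro nn_integral_cmult) measurable
    also have "\<dots> \<le> ennreal (exp (c * (norm (x - xs))\<^sup>2 + 3 * c * g1 * g2 * (norm (F x - p s1))\<^sup>2))
          * ennreal (exp (ell / (4 * (real K + 1))))"
      unfolding W_def using P by (intro mult_left_mono batch_noise_mgf y_in u q2) (auto simp: lam_eq)
    finally show ?thesis .
  qed
  \<comment> \<open>The first batch enters the exponent only quadratically, hence the linear
    coefficient 0.\<close>
  have first: "(\<integral>\<^sup>+\<omega>. ennreal (exp (3 * c * g1 * g2 * (norm (F x - p (\<lambda>i. sample \<omega> (1, k, i))))\<^sup>2)) \<partial>M)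
      \<le> ennreal (exp (ell / (4 * (real K + 1))))"
    using batch_noise_mgf[of 1 x 0 "3 * c * g1 * g2" lam1 k, OF _ x_in _ q1] P by (simp add: p_def lam_eq)
  define f where "f z = ennreal (\<Phi> (\<lambda>i. fst z (1, k, i)) (\<lambda>i. snd z (2, k, i)))"
    for z :: "(nat \<times> nat \<times> nat \<Rightarrow> 's) \<times> (nat \<times> nat \<times> nat \<Rightarrow> 's)"
  have ind: "indep_var (PiM (batch 1 k) (\<lambda>_. D)) (\<lambda>\<omega>. restrict (sample \<omega>) (batch 1 k))
      (PiM (batch 2 k) (\<lambda>_. D)) (\<lambda>\<omega>. restrict (sample \<omega>) (batch 2 k))"
    by (intro indep_var_restrict[OF indep_samples]) (auto simp: batch_def)
  have f_meas: "f \<in> borel_measurable (PiM (batch 1 k) (\<lambda>_. D) \<Otimes>\<^sub>M PiM (batch 2 k) (\<lambda>_. D))"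
  proof -
    have [measurable]: "(\<lambda>z. step x (\<lambda>i. fst z (1, k, i)) (\<lambda>i. snd z (2, k, i)))
        \<in> borel_measurable (PiM (batch 1 k) (\<lambda>_. D) \<Otimes>\<^sub>M PiM (batch 2 k) (\<lambda>_. D))"
      by (intro measurable_step measurable_compose[OF measurable_fst] measurable_compose[OF measurable_snd]
          measurable_component_singleton) (auto simp: batch_def)
    show ?thesis unfolding f_def \<Phi>_def by measurable
  qed
  \<comment> \<open>Restriction puts \<open>undefined\<close> outside the batch, but a step reads
    only the indices \<open>{1..m}\<close>.\<close>
  have restrict_step: "\<Phi> (\<lambda>i. restrict (sample \<omega>) (batch 1 k) (1, k, i)) (\<lambda>i. restrict (sample \<omega>') (batch 2 k) (2, k, i))
      = \<Phi> (\<lambda>i. sample \<omega> (1, k, i)) (\<lambda>i. sample \<omega>' (2, k, i))" for \<omega> \<omega>'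
    unfolding \<Phi>_def by (subst step_cong) (auto simp: batch_def)
  have "(\<integral>\<^sup>+\<omega>. ennreal (\<Phi> (\<lambda>i. sample \<omega> (1, k, i)) (\<lambda>i. sample \<omega> (2, k, i))) \<partial>M)
      = (\<integral>\<^sup>+\<omega>. (\<integral>\<^sup>+\<omega>'. ennreal (\<Phi> (\<lambda>i. sample \<omega> (1, k, i)) (\<lambda>i. sample \<omega>' (2, k, i))) \<partial>M) \<partial>M)"
    using nn_integral_indep_var[OF ind f_meas] by (simp only: f_def restrict_step fst_conv snd_conv)
  also have "\<dots> \<le> (\<integral>\<^sup>+\<omega>. ennreal (exp (c * (norm (x - xs))\<^sup>2) * exp (ell / (4 * (real K + 1))))
      * ennreal (exp (3 * c * g1 * g2 * (norm (F x - p (\<lambda>i. sample \<omega> (1, k, i))))\<^sup>2)) \<partial>M)"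
    by (intro nn_integral_mono order_trans[OF second])
      (simp add: exp_add mult_ac flip: ennreal_mult)
  also have "\<dots> = ennreal (exp (c * (norm (x - xs))\<^sup>2) * exp (ell / (4 * (real K + 1))))
      * (\<integral>\<^sup>+\<omega>. ennreal (exp (3 * c * g1 * g2 * (norm (F x - p (\<lambda>i. sample \<omega> (1, k, i))))\<^sup>2)) \<partial>M)"
    by (intro nn_integral_cmult) measurable
  also have "\<dots> \<le> ennreal (exp (c * (norm (x - xs))\<^sup>2) * exp (ell / (4 * (real K + 1))))
      * ennreal (exp (ell / (4 * (real K + 1))))"
    by (intro mult_left_mono first) auto
  also have "\<dots> = ennreal ((exp (ell / (4 * (real K + 1))) * exp (ell / (4 * (real K + 1)))) * exp (c * (norm (x - xs))\<^sup>2))"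
    by (simp only: ennreal_mult exp_ge_zero mult_nonneg_nonneg mult_ac)
  also have "exp (ell / (4 * (real K + 1))) * exp (ell / (4 * (real K + 1))) = exp (ell / (2 * (real K + 1)))"
  proof -
    have "a / (4 * b) + a / (4 * b) = a / (2 * b)" for a b :: real by (cases "b = 0") (auto simp: field_simps)
    then show ?thesis by (simp only: flip: exp_add)
  qed
  finally show ?thesis by (simp only: \<Phi>_def)
qed

subsection \<open>The stopped Lyapunov process\<close>

text \<open>The run is a function of a deterministic sample family, so that the family can be
  restricted and the run evaluated on product spaces.\<close>

definition iter :: "(nat \<times> nat \<times> nat \<Rightarrow> 's) \<Rightarrow> nat \<Rightarrow> 'a" where
  "iter p = clipped_SEG G g1 g2 (\<lambda>_. lam1) (\<lambda>_. lam2) (\<lambda>_. m) (\<lambda>_. m) (\<lambda>k i. p (1, k, i)) (\<lambda>k i. p (2, k, i)) x0"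

lemma iter_0 [simp]: "iter p 0 = x0" by (simp add: iter_def)

lemma iter_Suc [simp]: "iter p (Suc k) = step (iter p k) (\<lambda>i. p (1, k, i)) (\<lambda>i. p (2, k, i))"
  by (simp add: iter_def seg_step_def Let_def)

lemma prescribed_SEG_eq: "prescribed_SEG G x0 \<xi> L R \<sigma> \<beta> K \<omega> = iter (sample \<omega>)"
  by (simp add: prescribed_SEG_def iter_def sample_def)

definition past :: "nat \<Rightarrow> (nat \<times> nat \<times> nat) set" where
  "past k = {1, 2} \<times> {..<k} \<times> {1..m}"

text \<open>This is adaptedness, expressed without a filtration.\<close>

lemma iter_cong:
  assumes "\<And>t. t \<in> past k \<Longrightarrow> p t = q t"
  shows "iter p k = iter q k"
  using assms
proof (induction k)
  case (Suc k)
  have "iter p k = iter q k" by (rule Suc.IH, rule Suc.prems) (auto simp: past_def)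
  then show ?case unfolding iter_Suc
    by (simp only:) (rule step_cong; rule Suc.prems; simp add: past_def)
qed simp

lemma measurable_iter:
  assumes "\<And>t. t \<in> past k \<Longrightarrow> (\<lambda>\<omega>. p \<omega> t) \<in> measurable N D"
  shows "(\<lambda>\<omega>. iter (p \<omega>) k) \<in> borel_measurable N"
  using assms
proof (induction k)
  case (Suc k)
  have "(\<lambda>\<omega>. iter (p \<omega>) k) \<in> borel_measurable N"
    by (rule Suc.IH, rule Suc.prems) (auto simp: past_def)
  then show ?case unfolding iter_Suc
    by (rule measurable_step; intro Suc.prems) (auto simp: past_def)
qed simp

text \<open>The residual at \<open>iter p k\<close> is charged to the following step, so all
  residuals up to index \<open>K\<close> appear at time \<open>K + 1\<close>.\<close>

definition lyapunov :: "(nat \<times> nat \<times> nat \<Rightarrow> 's) \<Rightarrow> nat \<Rightarrow> real" where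
  "lyapunov p k = (norm (iter p k - xs))\<^sup>2 + g1 * g2 / 9 * (\<Sum>j<k. (norm (F (iter p j)))\<^sup>2)"

text \<open>Bounding the whole history makes the failure irreversible, as freezing requires.\<close>

definition alive :: "(nat \<times> nat \<times> nat \<Rightarrow> 's) \<Rightarrow> nat \<Rightarrow> bool" where
  "alive p k \<longleftrightarrow> (\<forall>j\<in>{..k}. lyapunov p j \<le> 4 * R\<^sup>2)"

text \<open>The exponential of the Lyapunov function, frozen at (a lower bound of) its first value above \<open>4 R\<^sup>2\<close>.\<close>

definition stopped :: "(nat \<times> nat \<times> nat \<Rightarrow> 's) \<Rightarrow> nat \<Rightarrow> real" where
  "stopped p k = (if alive p k then exp (c * lyapunov p k) else exp (c * (4 * R\<^sup>2)))"

section \<open>Adaptedness and measurability of the stopped process\<close>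

lemma past_mono: "j \<le> k \<Longrightarrow> past j \<subseteq> past k"
  by (auto simp: past_def)

lemma restrict_past:
  assumes "j \<le> k"
  shows "iter (restrict p (past k)) j = iter p j"
  using past_mono[OF assms] by (intro iter_cong) auto

lemma lyapunov_restrict: "j \<le> k \<Longrightarrow> lyapunov (restrict p (past k)) j = lyapunov p j"
  by (simp add: lyapunov_def restrict_past)

lemma alive_restrict: "alive (restrict p (past k)) k = alive p k"
  by (simp add: alive_def lyapunov_restrict)

lemma measurable_lyapunov:
  assumes "\<And>t. t \<in> past k \<Longrightarrow> (\<lambda>\<omega>. p \<omega> t) \<in> measurable N D" and "j \<le> k"
  shows "(\<lambda>\<omega>. lyapunov (p \<omega>) j) \<in> borel_measurable N"
proof -
  have [measurable]: "(\<lambda>\<omega>. iter (p \<omega>) i) \<in> borel_measurable N" if "i \<le> j" for i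
    using assms past_mono[of i k] that by (intro measurable_iter) auto
  show ?thesis unfolding lyapunov_def by measurable
qed

lemma measurable_alive:
  assumes "\<And>t. t \<in> past k \<Longrightarrow> (\<lambda>\<omega>. p \<omega> t) \<in> measurable N D"
  shows "Measurable.pred N (\<lambda>\<omega>. alive (p \<omega>) k)"
proof -
  have [measurable]: "(\<lambda>\<omega>. lyapunov (p \<omega>) j) \<in> borel_measurable N" if "j \<in> {..k}" for j
    using that by (intro measurable_lyapunov[OF assms]) auto
  show ?thesis unfolding alive_def by measurable
qed

lemma measurable_stopped:
  assumes "\<And>t. t \<in> past k \<Longrightarrow> (\<lambda>\<omega>. p \<omega> t) \<in> measurable N D"
  shows "(\<lambda>\<omega>. stopped (p \<omega>) k) \<in> borel_measurable N"
proof -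
  note [measurable] = measurable_lyapunov[OF assms order_refl] measurable_alive[OF assms]
  show ?thesis unfolding stopped_def by measurable
qed

lemma measurable_sample_past: "t \<in> past k \<Longrightarrow> (\<lambda>\<omega>. sample \<omega> t) \<in> measurable M D"
  using measurable_sample by (auto simp: past_def)

lemma c_pos: "0 < c" using ell_ge_1 R_pos by simp

lemma alive_dist: "alive p k \<Longrightarrow> norm (iter p k - xs) \<le> 2 * R"
proof -
  assume "alive p k"
  then have "lyapunov p k \<le> 4 * R\<^sup>2" by (simp add: alive_def)
  moreover have "0 \<le> g1 * g2 / 9 * (\<Sum>j<k. (norm (F (iter p j)))\<^sup>2)"
    using g_pos by (simp add: sum_nonneg)
  ultimately have "(norm (iter p k - xs))\<^sup>2 \<le> (2 * R)\<^sup>2"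
    by (simp add: lyapunov_def power_mult_distrib)
  then show ?thesis by (rule power2_le_imp_le) (use R_pos in simp)
qed

text \<open>Given the history, either the process is frozen, or the iterate is within
  \<open>2 * R\<close> of the solution and \<open>one_step_mgf\<close> applies to the fresh batches,
  which are independent of the history.\<close>

lemma stopped_supermartingale:
  "(\<integral>\<^sup>+\<omega>. ennreal (stopped (sample \<omega>) (Suc k)) \<partial>M)
    \<le> ennreal (exp (ell / (2 * (real K + 1)))) * (\<integral>\<^sup>+\<omega>. ennreal (stopped (sample \<omega>) k) \<partial>M)"
proof -
  define past_sum where "past_sum p = g1 * g2 / 9 * (\<Sum>j<k. (norm (F (iter p j)))\<^sup>2)" for p
  define \<Phi> where "\<Phi> x s1 s2 = exp (c * ((norm (step x s1 s2 - xs))\<^sup>2 + g1 * g2 / 9 * (norm (F x))\<^sup>2))" for x s1 s2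
  \<comment> \<open>The history comes from \<open>p\<close> and the fresh batches from
    \<open>q\<close>. No test of the new value is made, so that \<open>one_step_mgf\<close>
    fits.\<close>
  define h where "h p q = (if alive p k then exp (c * past_sum p) * \<Phi> (iter p k) (\<lambda>i. q (1, k, i)) (\<lambda>i. q (2, k, i))
      else exp (c * (4 * R\<^sup>2)))" for p q :: "nat \<times> nat \<times> nat \<Rightarrow> 's"
  define new :: "(nat \<times> nat \<times> nat) set" where "new = {1, 2} \<times> {k} \<times> {1..m}"
  have next_le: "stopped p (Suc k) \<le> h p p" for p
  proof -
    have lyap: "lyapunov p (Suc k) = past_sum p + ((norm (step (iter p k) (\<lambda>i. p (1, k, i)) (\<lambda>i. p (2, k, i)) - xs))\<^sup>2
        + g1 * g2 / 9 * (norm (F (iter p k)))\<^sup>2)"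
      by (simp add: lyapunov_def past_sum_def algebra_simps)
    have alive_Suc: "alive p (Suc k) \<longleftrightarrow> alive p k \<and> lyapunov p (Suc k) \<le> 4 * R\<^sup>2"
      by (auto simp: alive_def atMost_Suc)
    show ?thesis
    proof (cases "alive p k")
      case True
      then have "h p p = exp (c * lyapunov p (Suc k))"
        by (simp only: h_def \<Phi>_def lyap if_True distrib_left exp_add)
      moreover have "exp (c * (4 * R\<^sup>2)) \<le> exp (c * lyapunov p (Suc k))" if "\<not> lyapunov p (Suc k) \<le> 4 * R\<^sup>2"
        using that c_pos by (intro iffD2[OF exp_le_cancel_iff] mult_left_mono) auto
      ultimately show ?thesis using True by (auto simp: stopped_def alive_Suc)
    next
      case False
      then show ?thesis by (simp add: stopped_def h_def alive_Suc)
    qed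
  qed
  have step_le: "(\<integral>\<^sup>+\<omega>'. ennreal (h p (sample \<omega>')) \<partial>M) \<le> ennreal (exp (ell / (2 * (real K + 1)))) * ennreal (stopped p k)" for p
  proof (cases "alive p k")
    case True
    have [measurable]: "(\<lambda>\<omega>'. step (iter p k) (\<lambda>i. sample \<omega>' (1, k, i)) (\<lambda>i. sample \<omega>' (2, k, i))) \<in> borel_measurable M"
      by (intro measurable_step measurable_sample) auto
    have "(\<integral>\<^sup>+\<omega>'. ennreal (h p (sample \<omega>')) \<partial>M) = (\<integral>\<^sup>+\<omega>'. ennreal (exp (c * past_sum p))
        * ennreal (\<Phi> (iter p k) (\<lambda>i. sample \<omega>' (1, k, i)) (\<lambda>i. sample \<omega>' (2, k, i))) \<partial>M)"
      using True by (simp add: h_def \<Phi>_def flip: ennreal_mult)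
    also have "\<dots> = ennreal (exp (c * past_sum p))
        * (\<integral>\<^sup>+\<omega>'. ennreal (\<Phi> (iter p k) (\<lambda>i. sample \<omega>' (1, k, i)) (\<lambda>i. sample \<omega>' (2, k, i))) \<partial>M)"
      unfolding \<Phi>_def by (intro nn_integral_cmult) measurable
    also have "\<dots> \<le> ennreal (exp (c * past_sum p))
        * ennreal (exp (ell / (2 * (real K + 1))) * exp (c * (norm (iter p k - xs))\<^sup>2))"
      unfolding \<Phi>_def by (intro mult_left_mono one_step_mgf alive_dist True) auto
    also have "\<dots> = ennreal (exp (ell / (2 * (real K + 1)))) * ennreal (stopped p k)"
      using True by (simp add: stopped_def lyapunov_def past_sum_def algebra_simps flip: ennreal_mult exp_add)
    finally show ?thesis .
  next
    case False
    \<comment> \<open>A frozen value does not change, and the growth factor is at least 1.\<close>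
    have "exp 0 \<le> exp (ell / (2 * (real K + 1)))" using ell_ge_1 by (intro iffD2[OF exp_le_cancel_iff]) auto
    then have "1 * exp (c * (4 * R\<^sup>2)) \<le> exp (ell / (2 * (real K + 1))) * exp (c * (4 * R\<^sup>2))"
      by (intro mult_right_mono) auto
    then show ?thesis using False by (simp add: h_def stopped_def emeasure_space_1 flip: ennreal_mult)
  qed
  have ind: "indep_var (PiM (past k) (\<lambda>_. D)) (\<lambda>\<omega>. restrict (sample \<omega>) (past k))
      (PiM new (\<lambda>_. D)) (\<lambda>\<omega>. restrict (sample \<omega>) new)"
    by (intro indep_var_restrict[OF indep_samples]) (auto simp: past_def new_def)
  define f where "f z = ennreal (h (fst z) (snd z))" for z
  have f_meas: "f \<in> borel_measurable (PiM (past k) (\<lambda>_. D) \<Otimes>\<^sub>M PiM new (\<lambda>_. D))" (is "_ \<in> borel_measurable ?N")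
  proof -
    have p: "(\<lambda>z. fst z t) \<in> measurable ?N D" if "t \<in> past k" for t
      using that by (intro measurable_compose[OF measurable_fst] measurable_component_singleton)
    have q: "(\<lambda>z. snd z t) \<in> measurable ?N D" if "t \<in> new" for t
      using that by (intro measurable_compose[OF measurable_snd] measurable_component_singleton)
    have iter_meas [measurable]: "(\<lambda>z. iter (fst z) j) \<in> borel_measurable ?N" if "j \<le> k" for j
      using past_mono[OF that] by (intro measurable_iter p) auto
    note [measurable] = measurable_alive[OF p]
    have [measurable]: "(\<lambda>z. step (iter (fst z) k) (\<lambda>i. snd z (1, k, i)) (\<lambda>i. snd z (2, k, i))) \<in> borel_measurable ?N"
      by (intro measurable_step q iter_meas) (auto simp: new_def)
    have [measurable]: "(\<lambda>z. past_sum (fst z)) \<in> borel_measurable ?N" unfolding past_sum_def by measurable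
    have [measurable]: "(\<lambda>z. iter (fst z) k) \<in> borel_measurable ?N" by (rule iter_meas) simp
    show ?thesis unfolding f_def h_def \<Phi>_def by measurable
  qed
  have restrict_eq: "h (restrict p (past k)) (restrict q new) = h p q" for p q
  proof -
    have "step x (\<lambda>i. restrict q new (1, k, i)) (\<lambda>i. restrict q new (2, k, i))
        = step x (\<lambda>i. q (1, k, i)) (\<lambda>i. q (2, k, i))" for x
      by (rule step_cong) (auto simp: new_def)
    then show ?thesis
      by (simp only: h_def \<Phi>_def past_sum_def alive_restrict restrict_past[OF order_refl])
        (simp add: restrict_past)
  qed
  have "(\<integral>\<^sup>+\<omega>. ennreal (stopped (sample \<omega>) (Suc k)) \<partial>M) \<le> (\<integral>\<^sup>+\<omega>. ennreal (h (sample \<omega>) (sample \<omega>)) \<partial>M)"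
    by (intro nn_integral_mono ennreal_leI next_le)
  also have "\<dots> = (\<integral>\<^sup>+\<omega>. (\<integral>\<^sup>+\<omega>'. ennreal (h (sample \<omega>) (sample \<omega>')) \<partial>M) \<partial>M)"
    using nn_integral_indep_var[OF ind f_meas] by (simp add: f_def restrict_eq)
  also have "\<dots> \<le> (\<integral>\<^sup>+\<omega>. ennreal (exp (ell / (2 * (real K + 1)))) * ennreal (stopped (sample \<omega>) k) \<partial>M)"
    by (intro nn_integral_mono step_le)
  also have "\<dots> = ennreal (exp (ell / (2 * (real K + 1)))) * (\<integral>\<^sup>+\<omega>. ennreal (stopped (sample \<omega>) k) \<partial>M)"
    by (intro nn_integral_cmult measurable_compose[OF measurable_stopped measurable_ennreal] measurable_sample_past)
  finally show ?thesis .
qed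

lemma stopped_expectation:
  "(\<integral>\<^sup>+\<omega>. ennreal (stopped (sample \<omega>) k) \<partial>M) \<le> ennreal (exp (real k * (ell / (2 * (real K + 1))) + ell))"
proof (induction k)
  case 0
  have "(norm (x0 - xs))\<^sup>2 \<le> R\<^sup>2" using R_ge by (intro power_mono) auto
  moreover from this have "c * (norm (x0 - xs))\<^sup>2 \<le> c * R\<^sup>2" using c_pos by (intro mult_left_mono) auto
  moreover from calculation(1) have "(norm (x0 - xs))\<^sup>2 \<le> 4 * R\<^sup>2" using zero_le_power2[of R] by linarith
  ultimately have "stopped p 0 \<le> exp ell" for p
    using R_pos by (simp add: stopped_def alive_def lyapunov_def)
  then have "(\<integral>\<^sup>+\<omega>. ennreal (stopped (sample \<omega>) 0) \<partial>M) \<le> (\<integral>\<^sup>+\<omega>. ennreal (exp ell) \<partial>M)"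
    by (intro nn_integral_mono ennreal_leI)
  then show ?case by (simp add: emeasure_space_1)
next
  case (Suc k)
  have "(\<integral>\<^sup>+\<omega>. ennreal (stopped (sample \<omega>) (Suc k)) \<partial>M)
      \<le> ennreal (exp (ell / (2 * (real K + 1)))) * ennreal (exp (real k * (ell / (2 * (real K + 1))) + ell))"
    by (intro order_trans[OF stopped_supermartingale] mult_left_mono Suc.IH) simp
  also have "\<dots> = ennreal (exp (real (Suc k) * (ell / (2 * (real K + 1))) + ell))"
    by (simp add: algebra_simps add_divide_distrib flip: ennreal_mult exp_add)
  finally show ?case .
qed

section \<open>From the exponential moment to the high-probability bound\<close>

lemma alive_prob: "prob {\<omega> \<in> space M. alive (sample \<omega>) (K + 1)} \<ge> 1 - \<beta>"
proof -
  define B where "B = {\<omega> \<in> space M. \<not> alive (sample \<omega>) (K + 1)}"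
  have [measurable]: "Measurable.pred M (\<lambda>\<omega>. alive (sample \<omega>) (K + 1))"
    by (intro measurable_alive measurable_sample_past)
  have B [measurable]: "B \<in> sets M" unfolding B_def by measurable
  \<comment> \<open>Markov's inequality: on \<open>B\<close> the process is frozen at
    \<open>exp (4 * ell)\<close>.\<close>
  have "ennreal (exp (4 * ell)) * emeasure M B = (\<integral>\<^sup>+\<omega>. ennreal (exp (4 * ell)) * indicator B \<omega> \<partial>M)"
    by (simp add: nn_integral_cmult_indicator)
  also have "\<dots> \<le> (\<integral>\<^sup>+\<omega>. ennreal (stopped (sample \<omega>) (K + 1)) \<partial>M)"
    using R_pos by (intro nn_integral_mono) (auto simp: B_def stopped_def indicator_def)
  also have "\<dots> \<le> ennreal (exp (real (K + 1) * (ell / (2 * (real K + 1))) + ell))"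
    by (rule stopped_expectation)
  also have "real (K + 1) * (ell / (2 * (real K + 1))) + ell = 3 / 2 * ell"
    by (simp add: field_simps)
  finally have "exp (4 * ell) * prob B \<le> exp (3 / 2 * ell)"
    by (simp add: emeasure_eq_measure flip: ennreal_mult)
  then have "exp (- (4 * ell)) * (exp (4 * ell) * prob B) \<le> exp (- (4 * ell)) * exp (3 / 2 * ell)"
    by (rule mult_left_mono) simp
  then have "prob B \<le> exp (- (5 / 2 * ell))" by (simp flip: mult.assoc exp_add)
  also have "\<dots> \<le> exp (- ell)" using ell_ge_1 by simp
  also have "\<dots> = \<beta> / (6 * (real K + 1))" using \<beta> by (simp add: log_factor_def exp_minus)
  also have "\<dots> \<le> \<beta>" using \<beta> by (simp add: divide_le_eq)
  finally have "prob B \<le> \<beta>" .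
  moreover have "prob B = 1 - prob {\<omega> \<in> space M. alive (sample \<omega>) (K + 1)}"
    unfolding B_def by (rule prob_neg) measurable
  ultimately show ?thesis by simp
qed

lemma measurable_residual:
  "(\<lambda>\<omega>. mean_sq_residual F (prescribed_SEG G x0 \<xi> L R \<sigma> \<beta> K \<omega>) K) \<in> borel_measurable M"
proof -
  have [measurable]: "(\<lambda>\<omega>. iter (sample \<omega>) k) \<in> borel_measurable M" for k
    by (intro measurable_iter measurable_sample_past)
  show ?thesis unfolding mean_sq_residual_def prescribed_SEG_eq by measurable
qed

lemma alive_residual:
  assumes "alive p (K + 1)"
  shows "mean_sq_residual F (iter p) K \<le> 1843200 * L\<^sup>2 * R\<^sup>2 * ell\<^sup>2 / (real K + 1)"
proof -
  have "g1 * g2 / 9 * (\<Sum>j<K + 1. (norm (F (iter p j)))\<^sup>2) \<le> lyapunov p (K + 1)"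
    by (simp add: lyapunov_def)
  also have "\<dots> \<le> 4 * R\<^sup>2" using assms by (simp add: alive_def)
  \<comment> \<open>The constant is \<open>4 * 9 * 160 * 320 = 1843200\<close>.\<close>
  also have "4 * R\<^sup>2 = g1 * g2 / 9 * (1843200 * L\<^sup>2 * R\<^sup>2 * ell\<^sup>2)"
    using L_pos ell_ge_1 by (simp add: g_eq field_simps power2_eq_square)
  finally have "(\<Sum>j<K + 1. (norm (F (iter p j)))\<^sup>2) \<le> 1843200 * L\<^sup>2 * R\<^sup>2 * ell\<^sup>2"
    by (rule mult_left_le_imp_le) (use g_pos in simp)
  then show ?thesis
    by (simp add: mean_sq_residual_def divide_right_mono atLeast0AtMost flip: lessThan_Suc_atMost)
qed

lemma residual_bound:
  assumes "1843200 * L\<^sup>2 * R\<^sup>2 * ell\<^sup>2 / (real K + 1) \<le> b"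
  shows "prob {\<omega> \<in> space M. mean_sq_residual F (prescribed_SEG G x0 \<xi> L R \<sigma> \<beta> K \<omega>) K \<le> b} \<ge> 1 - \<beta>"
proof -
  note [measurable] = measurable_residual
  have "prob {\<omega> \<in> space M. alive (sample \<omega>) (K + 1)}
      \<le> prob {\<omega> \<in> space M. mean_sq_residual F (prescribed_SEG G x0 \<xi> L R \<sigma> \<beta> K \<omega>) K \<le> b}"
  proof (rule finite_measure_mono)
    show "{\<omega> \<in> space M. alive (sample \<omega>) (K + 1)}
        \<subseteq> {\<omega> \<in> space M. mean_sq_residual F (prescribed_SEG G x0 \<xi> L R \<sigma> \<beta> K \<omega>) K \<le> b}"
      using order_trans[OF alive_residual assms] by (auto simp: prescribed_SEG_eq)
  qed measurable
  then show ?thesis using alive_prob by linarith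
qed

end

section \<open>Parameters and complexity\<close>

text \<open>In terms of the step size, the unrounded batchsize formula reads \<open>3240 *
  g1\<^sup>2 * l * (K + 1) * \<sigma>\<^sup>2 / R\<^sup>2\<close>. The required lower bounds follow
  from \<open>g2 \<le> g1\<close>, \<open>1 \<le> l\<close> and
  \<open>sqrt (K + 1) \<le> K + 1\<close>.\<close>

lemma prescribed_parameters:
  fixes L R \<sigma> \<rho> \<beta> :: real and K :: nat
  assumes L: "0 < L" and R: "0 < R" and \<beta>: "0 < \<beta>" "\<beta> \<le> 1"
    and \<rho>: "\<rho> \<le> 1 / (640 * L * log_factor \<beta> K)"
  defines "l \<equiv> log_factor \<beta> K" and "g1 \<equiv> step1 L \<beta> K" and "g2 \<equiv> step2 L \<beta> K"
    and "m \<equiv> batchsize L R \<sigma> \<beta> K"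
  shows "g2 + 2 * \<rho> \<le> g1" "g1 \<le> 1 / (160 * L * l)"
    "real m \<ge> max 1 (216 * max (g1 * g2 * (real K + 1)) (sqrt (g1 ^ 3 * g2 * (real K + 1)) * l) * \<sigma>\<^sup>2 / R\<^sup>2)"
    "real m \<ge> max 1 (3240 * (real K + 1) * g2\<^sup>2 * \<sigma>\<^sup>2 * l / R\<^sup>2)"
proof -
  have l: "1 \<le> l" unfolding l_def using \<beta> by (rule log_factor_ge_1)
  have g1: "g1 = 1 / (160 * L * l)" by (simp add: g1_def step1_def l_def)
  have g2: "g2 = g1 / 2" by (simp add: g1_def g2_def step2_def)
  have g1_pos: "0 < g1" using L l by (simp add: g1)
  show "g2 + 2 * \<rho> \<le> g1" "g1 \<le> 1 / (160 * L * l)"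
    using \<rho> by (simp_all add: g2 g1 flip: l_def)
  have "81 * (real K + 1) * \<sigma>\<^sup>2 / (640 * L\<^sup>2 * R\<^sup>2 * l) \<le> real m"
    unfolding m_def l_def by (rule batchsize_ge(2))
  also have "81 * (real K + 1) * \<sigma>\<^sup>2 / (640 * L\<^sup>2 * R\<^sup>2 * l) = 3240 * (g1\<^sup>2 * l * (real K + 1)) * \<sigma>\<^sup>2 / R\<^sup>2"
    using L R l by (simp add: g1 field_simps power2_eq_square)
  finally have m: "3240 * (g1\<^sup>2 * l * (real K + 1)) * \<sigma>\<^sup>2 / R\<^sup>2 \<le> real m" .
  have m_ge: "a * \<sigma>\<^sup>2 / R\<^sup>2 \<le> real m" if "a \<le> 3240 * (g1\<^sup>2 * l * (real K + 1))" for a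
    using that by (intro order_trans[OF _ m] divide_right_mono mult_right_mono) auto
  have K: "sqrt (real K + 1) \<le> real K + 1" by (rule real_le_lsqrt) (auto simp: power2_eq_square)
  have sq: "g1\<^sup>2 * (real K + 1) \<le> g1\<^sup>2 * l * (real K + 1)"
    using l by (intro mult_right_mono) (auto simp: mult_le_cancel_left1)
  have "sqrt (g1 ^ 3 * g2 * (real K + 1)) \<le> sqrt ((g1\<^sup>2)\<^sup>2 * (real K + 1))"
    using g1_pos by (simp add: g2 power2_eq_square power3_eq_cube)
  also have "\<dots> = g1\<^sup>2 * sqrt (real K + 1)" by (simp only: real_sqrt_mult real_sqrt_abs abs_power2)
  also have "\<dots> \<le> g1\<^sup>2 * (real K + 1)" using K by (intro mult_left_mono) auto
  finally have "sqrt (g1 ^ 3 * g2 * (real K + 1)) * l \<le> g1\<^sup>2 * (real K + 1) * l"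
    using l by (intro mult_right_mono) auto
  then have "sqrt (g1 ^ 3 * g2 * (real K + 1)) * l \<le> g1\<^sup>2 * l * (real K + 1)" by (simp only: mult_ac)
  moreover have *: "g1 * g2 * (real K + 1) \<le> g1\<^sup>2 * (real K + 1)"
    using g1_pos by (simp add: g2 power2_eq_square mult_right_mono)
  ultimately have "max (g1 * g2 * (real K + 1)) (sqrt (g1 ^ 3 * g2 * (real K + 1)) * l) \<le> g1\<^sup>2 * l * (real K + 1)"
    by (intro max.boundedI order_trans[OF * sq])
  moreover have "0 \<le> g1\<^sup>2 * l * (real K + 1)" using l by simp
  ultimately have "216 * max (g1 * g2 * (real K + 1)) (sqrt (g1 ^ 3 * g2 * (real K + 1)) * l)
      \<le> 3240 * (g1\<^sup>2 * l * (real K + 1))"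
    by linarith
  then show "real m \<ge> max 1 (216 * max (g1 * g2 * (real K + 1)) (sqrt (g1 ^ 3 * g2 * (real K + 1)) * l) * \<sigma>\<^sup>2 / R\<^sup>2)"
    using batchsize_ge(1) by (intro max.boundedI m_ge) (auto simp: m_def)
  have "3240 * (real K + 1) * g2\<^sup>2 * l \<le> 3240 * (real K + 1) * g1\<^sup>2 * l"
    using l g1_pos by (intro mult_right_mono mult_left_mono power_mono) (auto simp: g2)
  also have "\<dots> = 3240 * (g1\<^sup>2 * l * (real K + 1))" by (simp only: mult_ac)
  finally have "3240 * (real K + 1) * g2\<^sup>2 * l \<le> 3240 * (g1\<^sup>2 * l * (real K + 1))" .
  from m_ge[OF this] show "real m \<ge> max 1 (3240 * (real K + 1) * g2\<^sup>2 * \<sigma>\<^sup>2 * l / R\<^sup>2)"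
    using batchsize_ge(1) by (intro max.boundedI) (auto simp: m_def mult_ac)
qed

section \<open>Numbers of iterations and of oracle calls\<close>

lemma ln_le_half: "ln x \<le> x / 2" if "0 < x" for x :: real
proof -
  have "ln (x / 2) \<le> x / 2 - 1" using that by (intro ln_le_minus_one) simp
  moreover have "ln (2::real) \<le> 1" using ln_le_minus_one[of "2::real"] by simp
  ultimately show ?thesis using that by (simp add: ln_div)
qed

lemma ln_2_ge: "1 / 2 \<le> ln (2::real)"
  using ln_ge_iff[of 2 "1/2"] exp_half_le2 by simp

text \<open>
  With \<open>B = L\<^sup>2 R\<^sup>2 / \<epsilon>\<close> and \<open>t = ln (B / \<beta>)\<close>, the choice \<open>K + 1 \<approx> 10\<^sup>1\<^sup>2 B t\<^sup>2\<close> makes the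
  logarithmic factor at most \<open>100 t\<close>, so that the bound \<open>1843200 \<epsilon> B ln\<^sup>2(\<dots>) / (K + 1)\<close> drops below \<open>\<epsilon>\<close>.
\<close>

lemma iteration_count:
  fixes B \<beta> :: real
  assumes B: "1 \<le> B" and \<beta>: "0 < \<beta>" "\<beta> \<le> 1" and B\<beta>: "2 \<le> B / \<beta>"
  defines "t \<equiv> ln (B / \<beta>)"
  obtains K :: nat where "real K + 1 \<le> 2 * 10 ^ 12 * (B * t\<^sup>2)"
    and "1843200 * (B * (log_factor \<beta> K)\<^sup>2) \<le> real K + 1" and "t \<le> log_factor \<beta> K"
proof -
  have t: "1 / 2 \<le> t"
  proof -
    have "ln 2 \<le> t" unfolding t_def using B\<beta> by simp
    then show ?thesis using ln_2_ge by simp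
  qed
  have "(1 / 2)\<^sup>2 \<le> t\<^sup>2" using t by (intro power_mono) auto
  then have t2: "1 / 4 \<le> t\<^sup>2" by (simp add: power2_eq_square)
  have Bt: "B / 4 \<le> B * t\<^sup>2" using mult_left_mono[OF t2, of B] B by simp
  define K where "K = nat \<lceil>10 ^ 12 * (B * t\<^sup>2)\<rceil>"
  have K: "10 ^ 12 * (B * t\<^sup>2) \<le> real K" "real K + 1 \<le> 10 ^ 12 * (B * t\<^sup>2) + 2"
  proof -
    have "x \<le> real (nat \<lceil>x\<rceil>) \<and> real (nat \<lceil>x\<rceil>) + 1 \<le> x + 2" if "0 \<le> x" for x :: real
      using that by linarith
    from this[of "10 ^ 12 * (B * t\<^sup>2)"] show "10 ^ 12 * (B * t\<^sup>2) \<le> real K" "real K + 1 \<le> 10 ^ 12 * (B * t\<^sup>2) + 2"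
      using B by (simp_all add: K_def)
  qed
  \<comment> \<open>The lower bound on \<open>B * t\<^sup>2\<close> lets the rounding error 2 be
    absorbed by doubling the constant.\<close>
  have "1 / 4 \<le> B * t\<^sup>2" using Bt B by linarith
  then have "10 ^ 12 * (1 / 4) \<le> 10 ^ 12 * (B * t\<^sup>2)" by (rule mult_left_mono) simp
  then have K_le: "real K + 1 \<le> 2 * 10 ^ 12 * (B * t\<^sup>2)" using K(2) by simp
  have pos: "0 < 6 * (real K + 1) / \<beta>" using \<beta> by simp
  have "1 * (B * t\<^sup>2) \<le> 10 ^ 12 * (B * t\<^sup>2)" using B by (intro mult_right_mono) auto
  from order_trans[OF this K(1)] have "B * t\<^sup>2 \<le> real K" by simp
  with Bt have "B / 4 \<le> real K" by (rule order_trans)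
  then have "B \<le> 6 * (real K + 1)" by simp
  then have "B / \<beta> \<le> 6 * (real K + 1) / \<beta>" using \<beta> by (intro divide_right_mono) auto
  then have t_le: "t \<le> log_factor \<beta> K"
    unfolding t_def log_factor_def using B\<beta> by simp
  have "6 * (real K + 1) \<le> 12 * 10 ^ 12 * (B * t\<^sup>2)" using K_le by simp
  then have "6 * (real K + 1) / \<beta> \<le> 12 * 10 ^ 12 * (B * t\<^sup>2) / \<beta>" using \<beta> by (intro divide_right_mono) auto
  \<comment> \<open>A power of two above \<open>12 * 10 ^ 12\<close> makes the logarithm of the
    constant a multiple of \<open>ln 2\<close>.\<close>
  also have "\<dots> \<le> 2 ^ 44 * (B / \<beta> * t\<^sup>2)"
    using \<beta> B by (simp add: divide_right_mono mult_right_mono)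
  finally have "log_factor \<beta> K \<le> ln (2 ^ 44 * (B / \<beta> * t\<^sup>2))"
    unfolding log_factor_def using pos by (intro iffD2[OF ln_le_cancel_iff]) auto
  also have "\<dots> = 44 * ln 2 + (t + 2 * ln t)"
  proof -
    have "ln (a ^ 44 * (b * t\<^sup>2)) = 44 * ln a + (ln b + 2 * ln t)" if "0 < a" "0 < b" for a b :: real
      using that t by (simp add: ln_mult ln_realpow)
    from this[of 2 "B / \<beta>"] show ?thesis using B \<beta> by (simp add: t_def)
  qed
  \<comment> \<open>From \<open>1 / 2 \<le> t\<close>,
    \<open>44 * ln 2 \<le> 44 \<le> 88 * t\<close>; moreover
    \<open>t + 2 * ln t \<le> 2 * t\<close>.\<close>
  also have "\<dots> \<le> 100 * t"
    using t ln_le_half[of t] ln_le_half[of "2::real"] by simp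
  finally have "(log_factor \<beta> K)\<^sup>2 \<le> (100 * t)\<^sup>2"
    using t t_le by (intro power_mono) auto
  then have "1843200 * (B * (log_factor \<beta> K)\<^sup>2) \<le> 1843200 * (B * (100 * t)\<^sup>2)"
    using B by (intro mult_left_mono) auto
  also have "\<dots> = 18432000000 * (B * t\<^sup>2)" by (simp add: power_mult_distrib)
  also have "\<dots> \<le> 10 ^ 12 * (B * t\<^sup>2)" using B by (intro mult_right_mono) auto
  finally have "1843200 * (B * (log_factor \<beta> K)\<^sup>2) \<le> real K + 1" using K(1) by linarith
  then show ?thesis by (rule that[OF K_le _ t_le])
qed

text \<open>Rounding up at most doubles \<open>max 1 a\<close>. The two cases of this maximum,
  multiplied by the number of iterations, yield the two terms \<open>A\<close> and \<open>S\<close>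
  of the bound.\<close>

lemma oracle_calls_le:
  assumes L: "0 < L" and R: "0 < R" and \<epsilon>: "0 < \<epsilon>" and t: "0 < t" "t \<le> log_factor \<beta> K"
    and K: "real K + 1 \<le> 2 * 10 ^ 12 * (L\<^sup>2 * R\<^sup>2 / \<epsilon> * t\<^sup>2)"
  shows "real ((batchsize L R \<sigma> \<beta> K + batchsize L R \<sigma> \<beta> K) * (K + 1))
    \<le> O_const * max (L\<^sup>2 * R\<^sup>2 / \<epsilon> * t\<^sup>2) (L\<^sup>2 * \<sigma>\<^sup>2 * R\<^sup>2 / \<epsilon>\<^sup>2 * t ^ 3)"
proof -
  define a where "a = 81 * (real K + 1) * \<sigma>\<^sup>2 / (640 * L\<^sup>2 * R\<^sup>2 * log_factor \<beta> K)"
  define A where "A = L\<^sup>2 * R\<^sup>2 / \<epsilon> * t\<^sup>2"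
  define S where "S = L\<^sup>2 * \<sigma>\<^sup>2 * R\<^sup>2 / \<epsilon>\<^sup>2 * t ^ 3"
  have A: "0 < A" and S: "0 \<le> S" using L R \<epsilon> t by (auto simp: A_def S_def)
  have a: "0 \<le> a" using L R t by (simp add: a_def)
  have "real (batchsize L R \<sigma> \<beta> K) \<le> max 1 a + 1"
    unfolding batchsize_def a_def[symmetric] by linarith
  then have batch: "real (batchsize L R \<sigma> \<beta> K) \<le> 2 * max 1 a" by linarith
  have first: "real K + 1 \<le> 2 * 10 ^ 12 * A" using K by (simp add: A_def)
  have "a * (real K + 1) = 81 * \<sigma>\<^sup>2 / (640 * L\<^sup>2 * R\<^sup>2 * log_factor \<beta> K) * (real K + 1)\<^sup>2"
    by (simp add: a_def power2_eq_square)
  \<comment> \<open>Squaring the iteration bound produces \<open>t ^ 4\<close>; the logarithm in the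
    denominator, bounded below by \<open>t\<close>, brings this to \<open>t ^ 3\<close>.\<close>
  also have "\<dots> \<le> 81 * \<sigma>\<^sup>2 / (640 * L\<^sup>2 * R\<^sup>2 * t) * (2 * 10 ^ 12 * A)\<^sup>2"
    using first t L R by (intro mult_mono power_mono divide_left_mono mult_left_mono) auto
  also have "\<dots> = 81 / 640 * (2 * 10 ^ 12)\<^sup>2 * S"
    using L R \<epsilon> t by (simp add: A_def S_def field_simps power2_eq_square power3_eq_cube)
  finally have second: "a * (real K + 1) \<le> 10 ^ 24 * S" using S by simp
  have "real ((batchsize L R \<sigma> \<beta> K + batchsize L R \<sigma> \<beta> K) * (K + 1)) = 2 * (real (batchsize L R \<sigma> \<beta> K) * (real K + 1))"
    by (simp add: algebra_simps)
  also have "\<dots> \<le> 2 * (2 * max 1 a * (real K + 1))"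
    using batch by (intro mult_left_mono mult_right_mono) auto
  also have "\<dots> = 4 * max (real K + 1) (a * (real K + 1))"
    by (simp add: max_mult_distrib_right)
  also have "\<dots> \<le> 4 * max (10 ^ 24 * A) (10 ^ 24 * S)"
    using first second A by (intro mult_left_mono max.mono) auto
  also have "\<dots> \<le> O_const * max A S"
    using A S by (simp add: O_const_def max_def)
  finally show ?thesis by (simp only: A_def S_def)
qed

lemma prescribed_guarantee:
  fixes M :: "'w measure" and D :: "'s measure" and G :: "'s \<Rightarrow> 'a::euclidean_space \<Rightarrow> 'a"
  assumes P: "SEG_problem D G F x0 xs R L \<sigma> \<rho>" and \<beta>: "0 < \<beta>" "\<beta> \<le> 1"
    and \<rho>: "\<rho> \<le> 1 / (640 * L * log_factor \<beta> K)" and \<xi>: "iid_samples M D (\<lambda>_ _. batchsize L R \<sigma> \<beta> K) \<xi>"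
    and b: "1843200 * L\<^sup>2 * R\<^sup>2 * (log_factor \<beta> K)\<^sup>2 / (real K + 1) \<le> b"
  shows "measure M {\<omega> \<in> space M. mean_sq_residual F (prescribed_SEG G x0 \<xi> L R \<sigma> \<beta> K \<omega>) K \<le> b} \<ge> 1 - \<beta>"
proof -
  interpret SEG_problem D G F x0 xs R L \<sigma> \<rho> by (rule P)
  interpret M: prob_space M using \<xi> by (simp add: iid_samples_def)
  interpret SEG_run D G F x0 xs R L \<sigma> \<rho> M K \<beta> \<xi> by unfold_locales (fact \<beta> \<rho> \<xi>)+
  show ?thesis using b by (rule residual_bound)
qed

text \<open>\<open>K\<close> is chosen before the problem instance is given. If
  \<open>\<epsilon> \<le> L\<^sup>2 * R\<^sup>2\<close>, \<open>iteration_count\<close> applies;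
  otherwise \<open>K = 0\<close> works, since the Lipschitz bound at the start already gives a
  residual below \<open>\<epsilon>\<close>.\<close>

lemma iteration_complexity:
  fixes L R \<sigma> \<epsilon> \<beta> :: real
  assumes L: "0 < L" and R: "0 < R" and \<epsilon>: "0 < \<epsilon>" and \<beta>: "0 < \<beta>" "\<beta> \<le> 1"
    and large: "2 \<le> L\<^sup>2 * R\<^sup>2 / (\<epsilon> * \<beta>)"
  shows "\<exists>K :: nat.
          real K \<le> O_const * (L\<^sup>2 * R\<^sup>2 / \<epsilon> * (ln (L\<^sup>2 * R\<^sup>2 / (\<epsilon> * \<beta>)))\<^sup>2) \<and>
          (\<epsilon> \<le> L\<^sup>2 * R\<^sup>2 \<longrightarrow>
            real ((batchsize L R \<sigma> \<beta> K + batchsize L R \<sigma> \<beta> K) * (K + 1)) \<le>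
              O_const * max (L\<^sup>2 * R\<^sup>2 / \<epsilon> * (ln (L\<^sup>2 * R\<^sup>2 / (\<epsilon> * \<beta>)))\<^sup>2)
                            (L\<^sup>2 * \<sigma>\<^sup>2 * R\<^sup>2 / \<epsilon>\<^sup>2 * (ln (L\<^sup>2 * R\<^sup>2 / (\<epsilon> * \<beta>))) ^ 3)) \<and>
          (\<forall>(D :: 's measure) (G :: 's \<Rightarrow> 'a::euclidean_space \<Rightarrow> 'a) F x0 xs \<rho> (M :: 'w measure) \<xi>.
             SEG_problem D G F x0 xs R L \<sigma> \<rho> \<longrightarrow> \<rho> \<le> 1 / (640 * L * log_factor \<beta> K) \<longrightarrow>
             iid_samples M D (\<lambda>_ _. batchsize L R \<sigma> \<beta> K) \<xi> \<longrightarrow>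
             measure M {\<omega> \<in> space M.
               mean_sq_residual F (prescribed_SEG G x0 \<xi> L R \<sigma> \<beta> K \<omega>) K \<le> \<epsilon>} \<ge> 1 - \<beta>)"
proof -
  define B where "B = L\<^sup>2 * R\<^sup>2 / \<epsilon>"
  define t where "t = ln (B / \<beta>)"
  have t_eq: "ln (L\<^sup>2 * R\<^sup>2 / (\<epsilon> * \<beta>)) = t" by (simp add: t_def B_def)
  have B\<beta>: "2 \<le> B / \<beta>" using large by (simp add: B_def)
  have B_pos: "0 < B" using L R \<epsilon> by (simp add: B_def)
  have t_pos: "0 < t" unfolding t_def using B\<beta> by (intro ln_gt_zero) linarith
  show ?thesis
  proof (cases "\<epsilon> \<le> L\<^sup>2 * R\<^sup>2")
    case True
    then have "1 \<le> B" using \<epsilon> by (simp add: B_def)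
    from iteration_count[OF this \<beta> B\<beta>, folded t_def] obtain K where
      K: "real K + 1 \<le> 2 * 10 ^ 12 * (B * t\<^sup>2)"
      and K_large: "1843200 * (B * (log_factor \<beta> K)\<^sup>2) \<le> real K + 1" and t_le: "t \<le> log_factor \<beta> K"
      by blast
    have calls: "real ((batchsize L R \<sigma> \<beta> K + batchsize L R \<sigma> \<beta> K) * (K + 1))
        \<le> O_const * max (L\<^sup>2 * R\<^sup>2 / \<epsilon> * t\<^sup>2) (L\<^sup>2 * \<sigma>\<^sup>2 * R\<^sup>2 / \<epsilon>\<^sup>2 * t ^ 3)"
      using K by (intro oracle_calls_le[OF L R \<epsilon> t_pos t_le]) (simp add: B_def)
    have "2 * 10 ^ 12 * (B * t\<^sup>2) \<le> O_const * (B * t\<^sup>2)"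
      using B_pos by (intro mult_right_mono) (auto simp: O_const_def)
    then have K_le: "real K \<le> O_const * (L\<^sup>2 * R\<^sup>2 / \<epsilon> * t\<^sup>2)" using K by (simp add: B_def)
    have "1843200 * L\<^sup>2 * R\<^sup>2 * (log_factor \<beta> K)\<^sup>2 = \<epsilon> * (1843200 * (B * (log_factor \<beta> K)\<^sup>2))"
      using \<epsilon> by (simp add: B_def)
    also have "\<dots> \<le> \<epsilon> * (real K + 1)" using K_large \<epsilon> by (intro mult_left_mono) auto
    finally have le_\<epsilon>: "1843200 * L\<^sup>2 * R\<^sup>2 * (log_factor \<beta> K)\<^sup>2 / (real K + 1) \<le> \<epsilon>"
      by (simp add: divide_le_eq)
    note guarantee = prescribed_guarantee[OF _ \<beta> _ _ le_\<epsilon>]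
    show ?thesis unfolding t_eq by (intro exI[of _ K] conjI allI impI K_le calls guarantee)
  next
    case False
    \<comment> \<open>With \<open>K = 0\<close> the average contains only the starting point, so the
      event is the whole space.\<close>
    have "measure M {\<omega> \<in> space M. mean_sq_residual F (prescribed_SEG G x0 \<xi> L R \<sigma> \<beta> 0 \<omega>) 0 \<le> \<epsilon>} \<ge> 1 - \<beta>"
      if P: "SEG_problem D G F x0 xs R L \<sigma> \<rho>" and \<xi>: "iid_samples M D (\<lambda>_ _. batchsize L R \<sigma> \<beta> 0) \<xi>"
      for D :: "'s measure" and G :: "'s \<Rightarrow> 'a \<Rightarrow> 'a" and F x0 xs \<rho> and M :: "'w measure" and \<xi>
    proof -
      interpret SEG_problem D G F x0 xs R L \<sigma> \<rho> by (rule P)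
      interpret M: prob_space M using \<xi> by (simp add: iid_samples_def)
      have "norm (F x0 - F xs) \<le> L * norm (x0 - xs)"
        using R_ge R by (intro lipschitz) (auto simp: dist_norm norm_minus_commute)
      also have "\<dots> \<le> L * R" using R_ge L by (intro mult_left_mono) auto
      finally have "norm (F x0) \<le> L * R" using projection(1) by (simp add: solutions_def)
      then have "(norm (F x0))\<^sup>2 \<le> (L * R)\<^sup>2" by (intro power_mono) auto
      then have "(norm (F x0))\<^sup>2 \<le> \<epsilon>" using False by (simp add: power_mult_distrib)
      then have "{\<omega> \<in> space M. mean_sq_residual F (prescribed_SEG G x0 \<xi> L R \<sigma> \<beta> 0 \<omega>) 0 \<le> \<epsilon>} = space M"
        by (simp add: mean_sq_residual_def prescribed_SEG_def)
      then show ?thesis using \<beta> by (simp add: M.prob_space)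
    qed
    moreover have "real 0 \<le> O_const * (L\<^sup>2 * R\<^sup>2 / \<epsilon> * t\<^sup>2)"
      using \<epsilon> by (simp add: O_const_def)
    ultimately show ?thesis unfolding t_eq using False by blast
  qed
qed

theorem corollaryC2:
  shows
    "(\<forall>(D :: 's measure) (G :: 's \<Rightarrow> 'a::euclidean_space \<Rightarrow> 'a) F x0 xs R L \<sigma> \<rho> (K :: nat) \<beta>.
        SEG_problem D G F x0 xs R L \<sigma> \<rho> \<longrightarrow> 0 < \<beta> \<longrightarrow> \<beta> \<le> 1 \<longrightarrow> 1 \<le> log_factor \<beta> K \<longrightarrow>
        \<rho> \<le> 1 / (640 * L * log_factor \<beta> K) \<longrightarrow>
        (let l = log_factor \<beta> K; \<gamma>1 = step1 L \<beta> K; \<gamma>2 = step2 L \<beta> K;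
             m1 = batchsize L R \<sigma> \<beta> K; m2 = batchsize L R \<sigma> \<beta> K in
          \<gamma>2 + 2 * \<rho> \<le> \<gamma>1 \<and> \<gamma>1 \<le> 1 / (160 * L * l) \<and>
          real m1 \<ge> max 1 (216 * max (\<gamma>1 * \<gamma>2 * (real K + 1))
                                        (sqrt (\<gamma>1 ^ 3 * \<gamma>2 * (real K + 1)) * l) * \<sigma>\<^sup>2 / R\<^sup>2) \<and>
          real m2 \<ge> max 1 (3240 * (real K + 1) * \<gamma>2\<^sup>2 * \<sigma>\<^sup>2 * l / R\<^sup>2) \<and>
          (\<forall>(M :: 'w measure) \<xi>.
             iid_samples M D (\<lambda>_ _. batchsize L R \<sigma> \<beta> K) \<xi> \<longrightarrow>
             measure M {\<omega> \<in> space M.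
               mean_sq_residual F (prescribed_SEG G x0 \<xi> L R \<sigma> \<beta> K \<omega>) K
                 \<le> 1843200 * L\<^sup>2 * R\<^sup>2 * l\<^sup>2 / (real K + 1)} \<ge> 1 - \<beta>)))
     \<and>
     (\<forall>L R \<sigma> \<epsilon> \<beta> :: real.
        0 < L \<longrightarrow> 0 < R \<longrightarrow> 0 < \<epsilon> \<longrightarrow> 0 < \<beta> \<longrightarrow> \<beta> \<le> 1 \<longrightarrow> 2 \<le> L\<^sup>2 * R\<^sup>2 / (\<epsilon> * \<beta>) \<longrightarrow>
        (\<exists>K :: nat.
          real K \<le> O_const * (L\<^sup>2 * R\<^sup>2 / \<epsilon> * (ln (L\<^sup>2 * R\<^sup>2 / (\<epsilon> * \<beta>)))\<^sup>2) \<and>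
          (\<epsilon> \<le> L\<^sup>2 * R\<^sup>2 \<longrightarrow>
            real ((batchsize L R \<sigma> \<beta> K + batchsize L R \<sigma> \<beta> K) * (K + 1)) \<le>
              O_const * max (L\<^sup>2 * R\<^sup>2 / \<epsilon> * (ln (L\<^sup>2 * R\<^sup>2 / (\<epsilon> * \<beta>)))\<^sup>2)
                            (L\<^sup>2 * \<sigma>\<^sup>2 * R\<^sup>2 / \<epsilon>\<^sup>2 * (ln (L\<^sup>2 * R\<^sup>2 / (\<epsilon> * \<beta>))) ^ 3)) \<and>
          (\<forall>(D :: 's measure) (G :: 's \<Rightarrow> 'a \<Rightarrow> 'a) F x0 xs \<rho> (M :: 'w measure) \<xi>.
             SEG_problem D G F x0 xs R L \<sigma> \<rho> \<longrightarrow> \<rho> \<le> 1 / (640 * L * log_factor \<beta> K) \<longrightarrow>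
             iid_samples M D (\<lambda>_ _. batchsize L R \<sigma> \<beta> K) \<xi> \<longrightarrow>
             measure M {\<omega> \<in> space M.
               mean_sq_residual F (prescribed_SEG G x0 \<xi> L R \<sigma> \<beta> K \<omega>) K \<le> \<epsilon>} \<ge> 1 - \<beta>)))"
proof (intro conjI allI impI, goal_cases)
  case (1 D G F x0 xs R L \<sigma> \<rho> K \<beta>)
  note L = SEG_problem.L_pos[OF 1(1)] and R = SEG_problem.R_pos[OF 1(1)]
  show ?case
    unfolding Let_def
    by (intro conjI allI impI prescribed_parameters[OF L R 1(2,3,5)] prescribed_guarantee[OF 1(1,2,3,5)] order_refl)
next
  case (2 L R \<sigma> \<epsilon> \<beta>)
  then show ?case by (rule iteration_complexity)
qed

end
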